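(* Costless Arctic auctions with binary-rational data reduce in strongly polynomial time to linear exchange markets by a many-one reduction. That is, there are (i) a strongly polynomial forward map taking any costless Arctic auction $\mathcal{A}$ to a single linear exchange market $\mathcal{E}$ that has a competitive equilibrium, and (ii) a strongly polynomial reverse map taking $\mathcal A$ and any (rational) competitive equilibrium of $\mathcal{E}$ to a competitive equilibrium of $\mathcal{A}$.
   Context: Costless Arctic auction. There are goods $[n]=\{1,\dots,n\}$ with supplies $\mathbf s\in\mathbb R^n_{>0}$ and bids $(\beta^k;\mathbf r^k)$, $k\in[m]$, with budget $\beta^k\in\mathbb R_{\ge 0}$ and value vector $\mathbf r^k\in\mathbb R^n_{\ge 0}$. At prices $\mathbf p\in\mathbb R^n_{>0}$, the demand of bid $k$ is $D^k(\mathbf p)=\operatorname{argmax}\{(\mathbf r^k-\mathbf p)\cdot\mathbf x : \mathbf x\in\mathbb R^n_{\ge 0},\ \mathbf p\cdot\mathbf x\le\beta^k\}$. The auctioneer can sell any bundle $\mathbf y$ with $\mathbf 0\le\mathbf y\le\mathbf s$ at no cost. A competitive equilibrium consists of prices $\mathbf p\in\mathbb R^n_{>0}$ and allocations $\mathbf x^k\in D^k(\mathbf p)$ such that $\sum_k\mathbf x^k$ maximises $\mathbf p\cdot\mathbf y$ over $\mathbf 0\le\mathbf y\le\mathbf s$ (equivalently $\sum_k\mathbf x^k=\mathbf s$). Standing assumption: every bid has positive value for at least one good, and for every good $i$ there is a bid $k$ with $\beta^k>0$ and $r^k_i>0$. Linear exchange market. Finitely many goods and agents $a$; each agent has an initial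 endowment vector $\boldsymbol\omega^a$ and a linear utility $u^a(\mathbf x)=\mathbf r^a\cdot\mathbf x$ on non-negative bundles $\mathbf x$, where $\boldsymbol\omega^a$ and $\mathbf r^a$ are non-negative. At prices $\mathbf p\geq \mathbf 0$, agent $a$ has income $\mathbf p\cdot\boldsymbol\omega^a$ and demands a non-negative bundle maximising $u^a(\mathbf x)$ subject to $\mathbf p\cdot\mathbf x\le\mathbf p\cdot\boldsymbol\omega^a$. A competitive equilibrium consists of prices and demanded allocations such that every good clears (total allocation equals total endowment). Strongly polynomial: the number of arithmetic operations (including comparisons) is bounded by a polynomial in the numbers of goods and bids, independently of the number of digits used to represent the input, and (on rational input) all numbers produced have encoding length polynomial in that of the map's input. *)

theory Defs
  imports
    Complex_Main
    "HOL-Library.Log_Nat"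
    "HOL-Computational_Algebra.Polynomial"
begin

section \<open>Auctions and exchange markets\<close>

text \<open>
  The goods are \<open>0, \<dots>, n - 1\<close>, and likewise for bids and agents. A vector is a function on
  \<^typ>\<open>nat\<close> of which only the values at these indices matter; no definition below
  looks at any other value.
\<close>

definition dot :: "nat \<Rightarrow> (nat \<Rightarrow> real) \<Rightarrow> (nat \<Rightarrow> real) \<Rightarrow> real" where
  "dot n x y = (\<Sum>i<n. x i * y i)"

record auction =
  num_goods :: nat
  num_bids :: nat
  good_supply :: "nat \<Rightarrow> real"
  budget :: "nat \<Rightarrow> real"
  bid_value :: "nat \<Rightarrow> nat \<Rightarrow> real"  \<comment> \<open>bid, good\<close>

record market =
  market_goods :: nat
  market_agents :: nat
  endowment :: "nat \<Rightarrow> nat \<Rightarrow> real"  \<comment> \<open>agent, good\<close>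
  utility :: "nat \<Rightarrow> nat \<Rightarrow> real"  \<comment> \<open>agent, good\<close>

text \<open>Prices and an allocation, for an auction (recipients are bids) or a market (agents).\<close>

record outcome =
  outcome_goods :: nat
  outcome_recipients :: nat
  price :: "nat \<Rightarrow> real"
  alloc :: "nat \<Rightarrow> nat \<Rightarrow> real"  \<comment> \<open>recipient, good\<close>

definition costless_arctic_auction :: "auction \<Rightarrow> bool" where
  "costless_arctic_auction A \<longleftrightarrow>
     (\<forall>i<num_goods A. good_supply A i > 0) \<and>
     (\<forall>k<num_bids A. budget A k \<ge> 0) \<and>
     (\<forall>k<num_bids A. \<forall>i<num_goods A. bid_value A k i \<ge> 0) \<and>
     (\<forall>k<num_bids A. \<exists>i<num_goods A. bid_value A k i > 0) \<and>
     (\<forall>i<num_goods A. \<exists>k<num_bids A. budget A k > 0 \<and> bid_value A k i > 0)"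

definition auction_demand :: "auction \<Rightarrow> (nat \<Rightarrow> real) \<Rightarrow> nat \<Rightarrow> (nat \<Rightarrow> real) set" where
  "auction_demand A p k =
     {x. is_arg_max
           (\<lambda>x. dot (num_goods A) (\<lambda>i. bid_value A k i - p i) x)
           (\<lambda>x. (\<forall>i<num_goods A. 0 \<le> x i) \<and> dot (num_goods A) p x \<le> budget A k)
           x}"

definition auction_equilibrium :: "auction \<Rightarrow> outcome \<Rightarrow> bool" where
  "auction_equilibrium A e \<longleftrightarrow>
     outcome_goods e = num_goods A \<and> outcome_recipients e = num_bids A \<and>
     (\<forall>i<num_goods A. price e i > 0) \<and>
     (\<forall>k<num_bids A. alloc e k \<in> auction_demand A (price e) k) \<and>
     is_arg_max
       (\<lambda>y. dot (num_goods A) (price e) y)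
       (\<lambda>y. \<forall>i<num_goods A. 0 \<le> y i \<and> y i \<le> good_supply A i)
       (\<lambda>i. \<Sum>k<num_bids A. alloc e k i)"

definition linear_exchange_market :: "market \<Rightarrow> bool" where
  "linear_exchange_market E \<longleftrightarrow>
     (\<forall>a<market_agents E. \<forall>i<market_goods E. endowment E a i \<ge> 0 \<and> utility E a i \<ge> 0)"

definition market_demand :: "market \<Rightarrow> (nat \<Rightarrow> real) \<Rightarrow> nat \<Rightarrow> (nat \<Rightarrow> real) set" where
  "market_demand E p a =
     {x. is_arg_max
           (\<lambda>x. dot (market_goods E) (utility E a) x)
           (\<lambda>x. (\<forall>i<market_goods E. 0 \<le> x i) \<and>
                dot (market_goods E) p x \<le> dot (market_goods E) p (endowment E a))
           x}"

definition market_equilibrium :: "market \<Rightarrow> outcome \<Rightarrow> bool" where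
  "market_equilibrium E e \<longleftrightarrow>
     outcome_goods e = market_goods E \<and> outcome_recipients e = market_agents E \<and>
     (\<forall>i<market_goods E. price e i \<ge> 0) \<and>
     (\<forall>a<market_agents E. alloc e a \<in> market_demand E (price e) a) \<and>
     (\<forall>i<market_goods E. (\<Sum>a<market_agents E. alloc e a i)
                         = (\<Sum>a<market_agents E. endowment E a i))"


section \<open>Explicit data and encoding length\<close>

text \<open>
  The data handed to an algorithm: a list of dimensions and a list of real matrices, each
  given by its numbers of rows and columns and its entries.
\<close>

type_synonym data = "nat list \<times> (nat \<times> nat \<times> (nat \<Rightarrow> nat \<Rightarrow> real)) list"

definition auction_data :: "auction \<Rightarrow> data" where
  "auction_data A =
     ([num_goods A, num_bids A],
      [(1, num_goods A, \<lambda>_. good_supply A),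
       (1, num_bids A, \<lambda>_. budget A),
       (num_bids A, num_goods A, bid_value A)])"

definition market_data :: "market \<Rightarrow> data" where
  "market_data E =
     ([market_goods E, market_agents E],
      [(market_agents E, market_goods E, endowment E),
       (market_agents E, market_goods E, utility E)])"

definition outcome_data :: "outcome \<Rightarrow> data" where
  "outcome_data e =
     ([outcome_goods e, outcome_recipients e],
      [(1, outcome_goods e, \<lambda>_. price e),
       (outcome_recipients e, outcome_goods e, alloc e)])"

definition join_data :: "data \<Rightarrow> data \<Rightarrow> data" where
  "join_data d d' = (fst d @ fst d', snd d @ snd d')"

definition rational_data :: "data \<Rightarrow> bool" where
  "rational_data d \<longleftrightarrow> (\<forall>(r, c, M) \<in> set (snd d). \<forall>i<r. \<forall>j<c. M i j \<in> \<rat>)"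

text \<open>
  Binary encoding length of a rational number: numerator and denominator in lowest terms, each
  with one extra bit (sign or separator).
\<close>

definition int_length :: "int \<Rightarrow> nat" where
  "int_length z = 1 + floorlog 2 (nat \<bar>z\<bar>)"

definition rat_length :: "real \<Rightarrow> nat" where
  "rat_length x =
     (case quotient_of (THE q. of_rat q = x) of (a, b) \<Rightarrow> int_length a + int_length b)"

definition data_length :: "data \<Rightarrow> nat" where
  "data_length d =
     (\<Sum>n\<leftarrow>fst d. int_length (int n)) +
     (\<Sum>(r, c, M)\<leftarrow>snd d. \<Sum>i<r. \<Sum>j<c. rat_length (M i j))"


section \<open>Algorithms\<close>

text \<open>
  A uniform real random-access machine with structured control flow. Its memory consists of
  natural-number index registers and of real cells \<open>cell s a i j\<close>, the entry \<open>(i, j)\<close> of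
  array \<open>a\<close>. A program names arrays statically and addresses entries through index registers:
  the address \<open>(a, u, v)\<close> denotes the entry of array \<open>a\<close> whose row and column are the
  contents of the registers \<open>u\<close> and \<open>v\<close>.

  Index registers can only be set to a constant of the program, copied, incremented and
  compared. In particular they grow by at most a constant of the program per step, so that the
  dimensions of the output, too, are bounded by the input dimensions and the running time.
\<close>

record machine =
  idx :: "nat \<Rightarrow> nat"
  cell :: "nat \<Rightarrow> nat \<Rightarrow> nat \<Rightarrow> real"

type_synonym address = "nat \<times> nat \<times> nat"

datatype arith = Add | Sub | Mul | Div

datatype test =
    Idx_Less nat nat
  | Real_Less address address

datatype program =
    Idx_Const nat nat
  | Idx_Copy nat nat
  | Idx_Inc nat
  | Real_Const address int
  | Real_Copy address address
  | Real_Arith arith address address address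
  | Seq program program
  | If test program program
  | While test program

fun read_cell :: "machine \<Rightarrow> address \<Rightarrow> real" where
  "read_cell s (a, u, v) = cell s a (idx s u) (idx s v)"

fun write_cell :: "machine \<Rightarrow> address \<Rightarrow> real \<Rightarrow> machine" where
  "write_cell s (a, u, v) x =
     s\<lparr>cell := (\<lambda>a' i j. if a' = a \<and> i = idx s u \<and> j = idx s v then x else cell s a' i j)\<rparr>"

definition write_idx :: "machine \<Rightarrow> nat \<Rightarrow> nat \<Rightarrow> machine" where
  "write_idx s u n = s\<lparr>idx := (idx s)(u := n)\<rparr>"

fun arith_value :: "arith \<Rightarrow> real \<Rightarrow> real \<Rightarrow> real" where
  "arith_value Add x y = x + y"
| "arith_value Sub x y = x - y"
| "arith_value Mul x y = x * y"
| "arith_value Div x y = x / y"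

fun test_value :: "test \<Rightarrow> machine \<Rightarrow> bool" where
  "test_value (Idx_Less u v) s \<longleftrightarrow> idx s u < idx s v"
| "test_value (Real_Less a b) s \<longleftrightarrow> read_cell s a < read_cell s b"

text \<open>
  \<open>exec P s t W s'\<close>: started in \<open>s\<close>, the program \<open>P\<close> halts in \<open>s'\<close> after \<open>t\<close> operations
  (arithmetic operations, comparisons, assignments and index operations, at unit cost), and \<open>W\<close>
  is the set of all numbers written to memory on the way. Division by zero has no execution.
\<close>

inductive exec :: "program \<Rightarrow> machine \<Rightarrow> nat \<Rightarrow> real set \<Rightarrow> machine \<Rightarrow> bool" where
  idx_const: "exec (Idx_Const u n) s 1 {real n} (write_idx s u n)"
| idx_copy: "exec (Idx_Copy u v) s 1 {real (idx s v)} (write_idx s u (idx s v))"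
| idx_inc: "exec (Idx_Inc u) s 1 {real (Suc (idx s u))} (write_idx s u (Suc (idx s u)))"
| real_const: "exec (Real_Const a z) s 1 {of_int z} (write_cell s a (of_int z))"
| real_copy: "exec (Real_Copy a b) s 1 {read_cell s b} (write_cell s a (read_cell s b))"
| real_arith:
    "x = arith_value f (read_cell s b) (read_cell s c) \<Longrightarrow> f = Div \<longrightarrow> read_cell s c \<noteq> 0 \<Longrightarrow>
     exec (Real_Arith f a b c) s 1 {x} (write_cell s a x)"
| seq: "exec P s t W s' \<Longrightarrow> exec Q s' t' W' s'' \<Longrightarrow> exec (Seq P Q) s (t + t') (W \<union> W') s''"
| if_true: "test_value b s \<Longrightarrow> exec P s t W s' \<Longrightarrow> exec (If b P Q) s (Suc t) W s'"
| if_false: "\<not> test_value b s \<Longrightarrow> exec Q s t W s' \<Longrightarrow> exec (If b P Q) s (Suc t) W s'"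
| while_false: "\<not> test_value b s \<Longrightarrow> exec (While b P) s 1 {} s"
| while_true:
    "test_value b s \<Longrightarrow> exec P s t W s' \<Longrightarrow> exec (While b P) s' t' W' s'' \<Longrightarrow>
     exec (While b P) s (Suc (t + t')) (W \<union> W') s''"

text \<open>
  Input: dimension \<open>i\<close> is in index register \<open>i\<close> and matrix \<open>a\<close> is in array \<open>a\<close>; all other memory,
  including the entries of array \<open>a\<close> beyond the matrix, is zero. Output: the same, except that
  other memory may have any contents.
\<close>

definition load :: "data \<Rightarrow> machine" where
  "load d =
     \<lparr>idx = (\<lambda>u. if u < length (fst d) then fst d ! u else 0),
      cell = (\<lambda>a i j.
        if a < length (snd d)
        then (case snd d ! a of (r, c, M) \<Rightarrow> if i < r \<and> j < c then M i j else 0)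
        else 0)\<rparr>"

definition stores :: "machine \<Rightarrow> data \<Rightarrow> bool" where
  "stores s d \<longleftrightarrow>
     (\<forall>u<length (fst d). idx s u = fst d ! u) \<and>
     (\<forall>a<length (snd d). case snd d ! a of (r, c, M) \<Rightarrow> \<forall>i<r. \<forall>j<c. cell s a i j = M i j)"

text \<open>
  The map \<open>f\<close> on the domain \<open>D\<close>, with inputs and outputs presented as \<open>enc_in\<close> and \<open>enc_out\<close>, is
  computed by a single program whose number of operations is polynomial in \<open>dims\<close> and which on
  rational input only produces numbers of polynomial encoding length.
\<close>

definition strongly_polynomial_map ::
  "('a \<Rightarrow> nat) \<Rightarrow> ('a \<Rightarrow> data) \<Rightarrow> ('b \<Rightarrow> data) \<Rightarrow> 'a set \<Rightarrow> ('a \<Rightarrow> 'b) \<Rightarrow> bool" where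
  "strongly_polynomial_map dims enc_in enc_out D f \<longleftrightarrow>
     (\<exists>P. \<exists>T L :: nat poly. \<forall>a\<in>D. \<exists>t W s.
        exec P (load (enc_in a)) t W s \<and>
        stores s (enc_out (f a)) \<and>
        t \<le> poly T (dims a) \<and>
        (rational_data (enc_in a) \<longrightarrow>
           (\<forall>w\<in>W. w \<in> \<rat> \<and> rat_length w \<le> poly L (data_length (enc_in a)))))"

text \<open>A polynomial in \<open>n\<close> and \<open>m\<close> is bounded by a polynomial in \<open>n + m\<close>, and conversely.\<close>

definition auction_size :: "auction \<Rightarrow> nat" where
  "auction_size A = num_goods A + num_bids A"

definition rational_auctions :: "auction set" where
  "rational_auctions = {A. costless_arctic_auction A \<and> rational_data (auction_data A)}"

definition rational_equilibria :: "market \<Rightarrow> outcome set" where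
  "rational_equilibria E = {e. market_equilibrium E e \<and> rational_data (outcome_data e)}"

end

(*
The goods are sold in a linear exchange market with one further good, money: every bid is an agent
endowed with its budget in money, values money at 1 per unit, and one seller owns the supply and
only values money. Dividing by the price of money turns a market equilibrium into an auction
equilibrium, because the seller keeps nothing.

An equilibrium exists because the spending b of the bids can be chosen to maximise the concave
potential "sum of b(k,i) ln (r(k,i) s(i)) minus sum of q(i) ln q(i) - q(i)", where q(i) is the total
spent on good i. At prices q(i) / s(i) its derivative in b(k,i) is the logarithm of the bang per buck
r(k,i) / p(i), so that the optimality conditions say that every bid spends only on goods of maximal
bang per buck, provided this is at least 1, and keeps money only if it is at most 1.
*)
theory Submission
  imports Defs "HOL-Analysis.Function_Topology" "HOL-Real_Asymp.Real_Asymp"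
begin

section \<open>Existence of an optimal spending plan\<close>

text \<open>The obstacle is the boundary: where some \<open>q i\<close> is 0 the potential has no
  finite derivative, so optimality conditions cannot be read off at once. Concavity is therefore
  used one-sidedly, with the derivative taken at a slightly moved plan, where the spending that
  changes is positive. Letting the move shrink first excludes \<open>q i = 0\<close>, by the
  assumption that every good is wanted by a bid with a positive budget, and only then yields the
  conditions at the optimum itself. Spending is chosen as the variable because the feasible plans
  form a compact set, so that a maximiser exists without a fixed point argument. Logarithms and real
  maximisers occur only in the existence proof and never in the computation. The forward map writes
  input entries and the constants 0 and 1, and the reverse map divides by a single price; this is
  why all lengths stay linear in the length of the input.\<close>

lemma continuous_on_mult_ln: "continuous_on {0..} (\<lambda>x::real. x * ln x)"
proof (rule continuous_on_eq_continuous_within[THEN iffD2], intro ballI)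
  fix x :: real
  assume "x \<in> {0..}"
  show "continuous (at x within {0..}) (\<lambda>x. x * ln x)"
  proof (cases "x = 0")
    case True
    \<comment> \<open>At 0 the product is 0 whatever value \<open>ln 0\<close> has, and this agrees
      with the one-sided limit.\<close>
    have "((\<lambda>x::real. x * ln x) \<longlongrightarrow> 0) (at_right 0)"
      by real_asymp
    with True show ?thesis
      by (simp add: continuous_within at_within_Ici_at_right)
  next
    case False
    with \<open>x \<in> {0..}\<close> have "isCont (\<lambda>x. x * ln x) x"
      by (intro continuous_intros) auto
    then show ?thesis
      by (rule continuous_at_imp_continuous_at_within)
  qed
qed

text \<open>Convexity of \<open>x ln x - x\<close>, whose derivative is \<open>ln\<close>: the
  tangent at \<open>y\<close> lies below the graph, which amounts to \<open>ln t \<le> t - 1\<close>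
  at \<open>t = y / x\<close>. Only the tangent point must be positive; \<open>x = 0\<close> is a
  good on which nothing is spent yet.\<close>

lemma mult_ln_tangent:
  fixes x y :: real
  assumes "0 \<le> x" "0 < y"
  shows "y * ln y - y - (x * ln x - x) \<le> (y - x) * ln y"
proof (cases "x = 0")
  case False
  with assms have "ln (y / x) \<le> y / x - 1"
    by (intro ln_le_minus_one) simp
  with False assms have "x * (ln y - ln x) \<le> x * (y / x - 1)"
    by (intro mult_left_mono) (simp_all add: ln_div)
  with False show ?thesis
    by (simp add: algebra_simps)
qed (use assms in simp)

section \<open>Spending plans: compactness and existence of an optimal one\<close>

locale arctic_auction =
  fixes A :: auction
  assumes arctic: "costless_arctic_auction A"
begin

abbreviation "n \<equiv> num_goods A"
abbreviation "m \<equiv> num_bids A"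
abbreviation "s \<equiv> good_supply A"
abbreviation "\<beta> \<equiv> budget A"
abbreviation "r \<equiv> bid_value A"

lemma s_pos: "i < n \<Longrightarrow> 0 < s i"
  and \<beta>_nonneg: "k < m \<Longrightarrow> 0 \<le> \<beta> k"
  and r_nonneg: "k < m \<Longrightarrow> i < n \<Longrightarrow> 0 \<le> r k i"
  and good_wanted: "i < n \<Longrightarrow> \<exists>k<m. 0 < \<beta> k \<and> 0 < r k i"
  using arctic by (auto simp: costless_arctic_auction_def)

text \<open>Worthless goods are kept out of the support because \<open>ln 0 = 0\<close> would let
  spending on them count as 0 instead of minus infinity. Money kept is the slack of the budget
  inequality. Vanishing beyond the goods, and in \<open>plans\<close> beyond the bids, makes the set
  of plans compact in the product topology.\<close>

definition rows :: "nat \<Rightarrow> (nat \<Rightarrow> real) set" where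
  "rows k = {v. (\<forall>i. 0 \<le> v i) \<and> (\<forall>i. v i \<noteq> 0 \<longrightarrow> i < n \<and> 0 < r k i) \<and> (\<Sum>i<n. v i) \<le> \<beta> k}"

definition plans :: "(nat \<Rightarrow> nat \<Rightarrow> real) set" where
  "plans = {b. (\<forall>k<m. b k \<in> rows k) \<and> (\<forall>k\<ge>m. b k = (\<lambda>_. 0))}"

definition spent :: "(nat \<Rightarrow> nat \<Rightarrow> real) \<Rightarrow> nat \<Rightarrow> real" where
  "spent b i = (\<Sum>k<m. b k i)"

text \<open>Shmyrev's program for linear Fisher markets, adapted to budgets that need not be spent.
  Kept money contributes 0, the logarithm of its bang per buck 1. The linear term in
  \<open>spent b i\<close> removes the constant 1 from the derivative of \<open>q ln q\<close>,
  which matters as soon as total spending can vary.\<close>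

definition potential :: "(nat \<Rightarrow> nat \<Rightarrow> real) \<Rightarrow> real" where
  "potential b =
     (\<Sum>i<n. (\<Sum>k<m. b k i * ln (r k i * s i)) - (spent b i * ln (spent b i) - spent b i))"

lemma continuous_on_entry [continuous_intros]:
  "continuous_on S (\<lambda>b :: nat \<Rightarrow> nat \<Rightarrow> real. b k i)"
  by (rule continuous_on_subset[OF continuous_on_product_then_coordinatewise[OF
        continuous_on_product_coordinates]]) simp

text \<open>The zero row and the rows with the whole budget on one valued good are the vertices of
  \<open>rows k\<close>; they are the only competitors needed against an optimal plan.\<close>

lemma rows_zero: "k < m \<Longrightarrow> (\<lambda>_. 0) \<in> rows k"
  by (simp add: rows_def \<beta>_nonneg)

lemma rows_single:
  assumes "k < m" "j < n" "0 < r k j"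
  shows "(\<lambda>i. if i = j then \<beta> k else 0) \<in> rows k"
  using assms \<beta>_nonneg by (auto simp: rows_def sum.delta)

lemma rows_le_budget:
  assumes "v \<in> rows k"
  shows "v i \<le> \<beta> k"
proof (cases "i < n")
  case True
  have "v i \<le> (\<Sum>i<n. v i)"
    using assms True by (intro member_le_sum) (auto simp: rows_def)
  with assms show ?thesis
    by (simp add: rows_def)
next
  case False
  have "0 \<le> (\<Sum>i<n. v i)"
    using assms by (intro sum_nonneg) (auto simp: rows_def)
  moreover have "v i = 0"
    using assms False by (auto simp: rows_def)
  ultimately show ?thesis
    using assms by (simp add: rows_def)
qed

text \<open>A product of compact intervals is compact by Tychonoff's theorem, and finitely many
  closed budget constraints cut \<open>plans\<close> out of it. All but finitely many of the
  intervals are \<open>{0}\<close>.\<close>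

lemma compact_plans: "compact plans"
proof -
  define box where "box k i = {0..if k < m \<and> i < n \<and> 0 < r k i then \<beta> k else 0}" for k i
  have "compactin euclidean (PiE UNIV (\<lambda>k. PiE UNIV (box k)))"
    unfolding euclidean_product_topology[symmetric] compactin_PiE
    by (simp add: box_def)
  then have compact: "compact (PiE UNIV (\<lambda>k. PiE UNIV (box k)))"
    by simp
  have "closed {b :: nat \<Rightarrow> nat \<Rightarrow> real. \<forall>k<m. (\<Sum>i<n. b k i) \<le> \<beta> k}"
  proof -
    have "{b :: nat \<Rightarrow> nat \<Rightarrow> real. \<forall>k<m. (\<Sum>i<n. b k i) \<le> \<beta> k}
        = (\<Inter>k\<in>{..<m}. {b. (\<Sum>i<n. b k i) \<le> \<beta> k})"
      by auto
    also have "closed \<dots>"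
      by (intro closed_INT ballI closed_Collect_le continuous_intros)
    finally show ?thesis .
  qed
  with compact have "compact (PiE UNIV (\<lambda>k. PiE UNIV (box k)) \<inter>
    {b. \<forall>k<m. (\<Sum>i<n. b k i) \<le> \<beta> k})"
    by (rule compact_Int_closed)
  also have "PiE UNIV (\<lambda>k. PiE UNIV (box k)) \<inter> {b. \<forall>k<m. (\<Sum>i<n. b k i) \<le> \<beta> k} = plans"
    (is "?L = _")
  proof (intro equalityI subsetI)
    fix b assume b: "b \<in> ?L"
    then have box: "b k i \<in> box k i" for k i
      by (auto simp: PiE_iff)
    have nonneg: "0 \<le> b k i" for k i
      using box[of k i] by (simp add: box_def)
    have zero: "b k i = 0" if "\<not> (k < m \<and> i < n \<and> 0 < r k i)" for k i
      using box[of k i] that by (simp add: box_def)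
    have "b k \<in> rows k" if "k < m" for k
      using b that nonneg zero by (force simp: rows_def)
    moreover have "b k = (\<lambda>_. 0)" if "k \<ge> m" for k
      using that zero by (intro ext) simp
    ultimately show "b \<in> plans"
      by (simp add: plans_def)
  next
    fix b assume b: "b \<in> plans"
    have "b k i \<in> box k i" for k i
    proof (cases "k < m")
      case True
      with b have row: "b k \<in> rows k" by (simp add: plans_def)
      with rows_le_budget[OF this, of i] True show ?thesis
        by (auto simp: rows_def box_def intro!: eq_refl)
    qed (use b in \<open>auto simp: plans_def box_def\<close>)
    with b show "b \<in> ?L"
      by (auto simp: PiE_iff plans_def rows_def)
  qed
  finally show ?thesis .
qed

lemma plans_nonneg: "b \<in> plans \<Longrightarrow> 0 \<le> b k i"
  by (cases "k < m") (auto simp: plans_def rows_def)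

lemma spent_nonneg: "b \<in> plans \<Longrightarrow> 0 \<le> spent b i"
  unfolding spent_def by (intro sum_nonneg) (simp add: plans_nonneg)

lemma continuous_on_spent [continuous_intros]: "continuous_on S (\<lambda>b. spent b i)"
  unfolding spent_def by (intro continuous_intros)

lemma continuous_on_potential: "continuous_on plans potential"
  unfolding potential_def
  by (intro continuous_intros continuous_on_compose2[OF continuous_on_mult_ln])
    (auto simp: spent_nonneg)

lemma ex_optimal_plan: "\<exists>b\<in>plans. \<forall>b'\<in>plans. potential b' \<le> potential b"
proof -
  have "(\<lambda>_ _. 0) \<in> plans"
    by (simp add: plans_def rows_zero)
  then show ?thesis
    using continuous_attains_sup[OF compact_plans _ continuous_on_potential] by blast
qed

end

section \<open>First-order conditions at an optimal plan\<close>

locale optimal_plan = arctic_auction +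
  fixes b :: "nat \<Rightarrow> nat \<Rightarrow> real"
  assumes plan: "b \<in> plans"
    and optimal: "\<And>b'. b' \<in> plans \<Longrightarrow> potential b' \<le> potential b"
begin

abbreviation "q \<equiv> spent b"

lemma b_row: "k < m \<Longrightarrow> b k \<in> rows k"
  using plan by (simp add: plans_def)

text \<open>
  Since \<open>x ln x - x\<close> is convex, the derivative of the potential at the perturbed plan, in the
  direction of the perturbation, bounds the increase of the potential from below.
\<close>

lemma perturbation:
  assumes k: "k < m" and v: "v \<in> rows k" and \<epsilon>: "0 < \<epsilon>" "\<epsilon> \<le> 1"
    and pos: "\<And>i. i < n \<Longrightarrow> 0 < q i + \<epsilon> * (v i - b k i) \<or> v i = b k i"
  shows "(\<Sum>i<n. (v i - b k i) * (ln (r k i * s i) - ln (q i + \<epsilon> * (v i - b k i)))) \<le> 0"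
proof -
  \<comment> \<open>Only row \<open>k\<close> moves, to a convex combination of \<open>b k\<close>
    and \<open>v\<close>, so that feasibility is inherited from both.\<close>
  define b' where "b' = b(k := (\<lambda>i. b k i + \<epsilon> * (v i - b k i)))"
  have row: "b' k i = (1 - \<epsilon>) * b k i + \<epsilon> * v i" for i
    by (simp add: b'_def algebra_simps)
  have "b' k \<in> rows k"
  proof -
    have "(\<Sum>i<n. b' k i) = (1 - \<epsilon>) * (\<Sum>i<n. b k i) + \<epsilon> * (\<Sum>i<n. v i)"
      by (simp add: row sum.distrib sum_distrib_left)
    also have "\<dots> \<le> (1 - \<epsilon>) * \<beta> k + \<epsilon> * \<beta> k"
      using v b_row[OF k] \<epsilon> by (intro add_mono mult_left_mono) (auto simp: rows_def)
    finally have "(\<Sum>i<n. b' k i) \<le> \<beta> k"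
      by (simp add: algebra_simps)
    moreover have "0 \<le> b' k i" for i
      using v b_row[OF k] \<epsilon> by (simp add: row rows_def)
    moreover have "i < n \<and> 0 < r k i" if "b' k i \<noteq> 0" for i
    proof -
      have "b k i \<noteq> 0 \<or> v i \<noteq> 0"
        using that by (auto simp: row)
      with v b_row[OF k] show ?thesis
        by (auto simp: rows_def)
    qed
    ultimately show ?thesis
      by (simp add: rows_def)
  qed
  then have b': "b' \<in> plans"
    using plan k by (auto simp: plans_def b'_def)
  have split: "(\<Sum>j<m. g j (b' j)) = g k (b' k) - g k (b k) + (\<Sum>j<m. g j (b j))"
    for g :: "nat \<Rightarrow> (nat \<Rightarrow> real) \<Rightarrow> real"
    using k by (simp add: b'_def sum.remove[of "{..<m}" k])
  have spent: "spent b' i = q i + \<epsilon> * (v i - b k i)" for i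
    unfolding spent_def using split[of "\<lambda>_ x. x i"] by (simp add: b'_def)
  have "\<epsilon> * (\<Sum>i<n. (v i - b k i) * (ln (r k i * s i) - ln (q i + \<epsilon> * (v i - b k i))))
      \<le> potential b' - potential b"
    unfolding potential_def sum_subtractf[symmetric] sum_distrib_left
  proof (rule sum_mono)
    fix i assume "i \<in> {..<n}"
    then have i: "i < n" by simp
    have "(\<Sum>j<m. b' j i * ln (r j i * s i)) - (\<Sum>j<m. b j i * ln (r j i * s i))
        = \<epsilon> * (v i - b k i) * ln (r k i * s i)"
      using split[of "\<lambda>j x. x i * ln (r j i * s i)"] by (simp add: b'_def algebra_simps)
    moreover have "(spent b' i * ln (spent b' i) - spent b' i) - (q i * ln (q i) - q i)
        \<le> \<epsilon> * (v i - b k i) * ln (q i + \<epsilon> * (v i - b k i))"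
    proof (cases "v i = b k i")
      case False
      with pos[OF i] have "0 < spent b' i"
        by (simp add: spent)
      \<comment> \<open>The tangent is taken at the new spending, which is positive; the old
        spending \<open>q i\<close> may still be 0.\<close>
      from mult_ln_tangent[OF spent_nonneg[OF plan, of i] this] show ?thesis
        by (simp add: spent)
    qed (simp add: spent)
    ultimately show "\<epsilon> * ((v i - b k i) * (ln (r k i * s i) - ln (q i + \<epsilon> * (v i - b k i))))
      \<le> (\<Sum>j<m. b' j i * ln (r j i * s i)) - (spent b' i * ln (spent b' i) - spent b' i)
        - ((\<Sum>j<m. b j i * ln (r j i * s i)) - (q i * ln (q i) - q i))"
      by (simp add: algebra_simps)
  qed
  also have "\<dots> \<le> 0"
    using optimal[OF b'] by simp
  finally show ?thesis
    using \<epsilon> by (simp add: mult_le_0_iff)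
qed

lemma b_le_spent: "k < m \<Longrightarrow> b k i \<le> q i"
  unfolding spent_def using plans_nonneg[OF plan] by (intro member_le_sum) auto

text \<open>If nothing were spent on a good, a first unit of money moved to it would have infinite return.\<close>

lemma spent_pos:
  assumes j: "j < n"
  shows "0 < q j"
proof (rule ccontr)
  assume "\<not> 0 < q j"
  with spent_nonneg[OF plan] have qj: "q j = 0"
    by (simp add: order_antisym)
  obtain k where k: "k < m" "0 < \<beta> k" "0 < r k j"
    using good_wanted[OF j] by blast
  have bkj: "b k j = 0"
    using b_le_spent[OF k(1), of j] qj plans_nonneg[OF plan, of k j] by simp
  define v where "v = (\<lambda>i. if i = j then \<beta> k else 0)"
  \<comment> \<open>The first-order loss from withdrawing money from the other goods. It has a
    finite limit, while the return on \<open>j\<close> grows like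
    \<open>- \<beta> k * ln \<epsilon>\<close>.\<close>
  define f where "f \<epsilon> = (\<Sum>i\<in>{..<n} - {j}. b k i * (ln (r k i * s i) - ln (q i - \<epsilon> * b k i)))"
    for \<epsilon>
  have v: "v \<in> rows k"
    unfolding v_def using k j by (intro rows_single)
  have ineq: "\<beta> k * (ln (r k j * s j) - ln (\<epsilon> * \<beta> k)) \<le> f \<epsilon>" if \<epsilon>: "0 < \<epsilon>" "\<epsilon> < 1" for \<epsilon>
  proof -
    have pos: "0 < q i + \<epsilon> * (v i - b k i) \<or> v i = b k i" for i
    proof (cases "i = j")
      case False
      have "\<epsilon> * b k i < b k i" if "b k i \<noteq> 0"
        using that \<epsilon> plans_nonneg[OF plan, of k i] by (simp add: less_le)
      with b_le_spent[OF k(1), of i] False show ?thesis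
        by (force simp: v_def)
    qed (use \<epsilon> k qj bkj in \<open>simp add: v_def\<close>)
    have "(\<Sum>i<n. (v i - b k i) * (ln (r k i * s i) - ln (q i + \<epsilon> * (v i - b k i)))) \<le> 0"
      using \<epsilon> by (intro perturbation k v pos) auto
    moreover have "(\<Sum>i\<in>{..<n} - {j}.
        (v i - b k i) * (ln (r k i * s i) - ln (q i + \<epsilon> * (v i - b k i)))) = - f \<epsilon>"
      unfolding f_def sum_negf[symmetric] by (intro sum.cong) (auto simp: v_def algebra_simps)
    ultimately show ?thesis
      using j by (simp add: sum.remove[of "{..<n}" j] v_def qj bkj)
  qed
  have "(f \<longlongrightarrow> f 0) (at_right 0)"
    unfolding f_def
  proof (intro tendsto_sum)
    fix i assume "i \<in> {..<n} - {j}"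
    show "((\<lambda>\<epsilon>. b k i * (ln (r k i * s i) - ln (q i - \<epsilon> * b k i))) \<longlongrightarrow>
        b k i * (ln (r k i * s i) - ln (q i - 0 * b k i))) (at_right 0)"
    \<comment> \<open>If \<open>b k i = 0\<close> the term is constantly 0, even when
      \<open>q i = 0\<close>; otherwise \<open>q i \<ge> b k i > 0\<close> and the logarithm is
      continuous at \<open>q i\<close>.\<close>
    proof (cases "b k i = 0")
      case False
      then have "q i \<noteq> 0"
        using b_le_spent[OF k(1), of i] plans_nonneg[OF plan, of k i] by auto
      then show ?thesis
        by (intro tendsto_intros) auto
    qed simp
  qed
  moreover have "\<forall>\<^sub>F \<epsilon> in at_right 0. \<beta> k * (ln (r k j * s j) - ln (\<epsilon> * \<beta> k)) \<le> f \<epsilon>"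
    using ineq by (auto simp: eventually_at_right_field intro!: exI[of _ 1])
  moreover have "filterlim (\<lambda>\<epsilon>. \<beta> k * (ln (r k j * s j) - ln (\<epsilon> * \<beta> k))) at_top (at_right 0)"
    using k(2) by real_asymp
  ultimately have "filterlim f at_top (at_right 0)"
    by (blast intro: filterlim_at_top_mono)
  with \<open>(f \<longlongrightarrow> f 0) (at_right 0)\<close> show False
    using not_tendsto_and_filterlim_at_infinity[of "at_right 0" f "f 0"]
    by (auto simp: filterlim_at_top_imp_at_infinity)
qed

text \<open>For \<open>r k i > 0\<close> this is the logarithm of the bang per buck at price
  \<open>q i / s i\<close>. For \<open>r k i = 0\<close> its value is meaningless, but there every
  row of \<open>rows k\<close> vanishes.\<close>

definition gain :: "nat \<Rightarrow> nat \<Rightarrow> real" where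
  "gain k i = ln (r k i * s i) - ln (q i)"

text \<open>With every \<open>q i\<close> positive the logarithms are continuous, so the
  perturbation inequality survives the limit. It then says that \<open>b k\<close> maximises a
  linear functional over \<open>rows k\<close>, which can be tested at the vertices.\<close>

lemma row_optimal:
  assumes k: "k < m" and v: "v \<in> rows k"
  shows "(\<Sum>i<n. v i * gain k i) \<le> (\<Sum>i<n. b k i * gain k i)"
proof -
  define f where
    "f \<epsilon> = (\<Sum>i<n. (v i - b k i) * (ln (r k i * s i) - ln (q i + \<epsilon> * (v i - b k i))))" for \<epsilon>
  have "(f \<longlongrightarrow> f 0) (at_right 0)"
    unfolding f_def using spent_pos by (intro tendsto_intros) (auto simp: less_imp_neq[symmetric])
  moreover have "\<forall>\<^sub>F \<epsilon> in at_right 0. f \<epsilon> \<le> 0"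
  proof -
    have "\<forall>\<^sub>F \<epsilon> in at_right 0. 0 < q i + \<epsilon> * (v i - b k i)" if "i < n" for i
    proof -
      have "((\<lambda>\<epsilon>. q i + \<epsilon> * (v i - b k i)) \<longlongrightarrow> q i + 0 * (v i - b k i)) (at_right 0)"
        by (intro tendsto_intros)
      then show ?thesis
        by (rule order_tendstoD) (simp add: spent_pos that)
    qed
    then have "\<forall>\<^sub>F \<epsilon> in at_right 0. \<forall>i\<in>{..<n}. 0 < q i + \<epsilon> * (v i - b k i)"
      by (intro eventually_ball_finite) auto
    moreover have "\<forall>\<^sub>F \<epsilon>::real in at_right 0. 0 < \<epsilon> \<and> \<epsilon> \<le> 1"
      by (auto simp: eventually_at_right_field intro!: exI[of _ 1])
    ultimately show ?thesis
      by eventually_elim (auto simp: f_def intro!: perturbation k v)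
  qed
  ultimately have "f 0 \<le> 0"
    by (intro tendsto_upperbound) auto
  then show ?thesis
    by (simp add: f_def gain_def left_diff_distrib sum_subtractf)
qed

text \<open>The multiplier \<open>\<mu>\<close> is the best bang per buck available to the bid,
  money included. The best vertex has value \<open>\<beta> k * M\<close> with
  \<open>\<mu> = exp M\<close>; since \<open>b k\<close> does at least as well, a sum of nonnegative
  slacks is at most 0 and each slack vanishes.\<close>

lemma complementary_slackness:
  assumes k: "k < m"
  shows "\<exists>\<mu>\<ge>1. (\<forall>i<n. r k i \<le> \<mu> * (q i / s i)) \<and> (\<forall>i<n. 0 < b k i \<longrightarrow> r k i = \<mu> * (q i / s i)) \<and>
    ((\<Sum>i<n. b k i) < \<beta> k \<longrightarrow> \<mu> = 1)"
proof -
  \<comment> \<open>The element 0 stands for keeping money and forces \<open>exp M\<close> to be at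
    least 1.\<close>
  define G where "G = insert 0 (gain k ` {i. i < n \<and> 0 < r k i})"
  define M where "M = Max G"
  have fin: "finite G" and "G \<noteq> {}"
    by (auto simp: G_def)
  have M_nonneg: "0 \<le> M" and gain_le: "\<And>i. i < n \<Longrightarrow> 0 < r k i \<Longrightarrow> gain k i \<le> M"
    using fin by (auto simp: M_def G_def intro!: Max_ge)
  have row: "b k \<in> rows k"
    using k by (rule b_row)
  have "M \<in> G"
    unfolding M_def using fin \<open>G \<noteq> {}\<close> by (rule Max_in)
  then consider "M = 0" | j where "j < n" "0 < r k j" "M = gain k j"
    by (auto simp: G_def)
  then have "\<beta> k * M \<le> (\<Sum>i<n. b k i * gain k i)"
  proof cases
    case 1
    then show ?thesis
      using row_optimal[OF k rows_zero[OF k]] by simp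
  next
    case 2
    have "(\<Sum>i<n. (if i = j then \<beta> k else 0) * gain k i) = \<beta> k * M"
      using 2 by (subst sum.remove[of _ j]) auto
    with row_optimal[OF k rows_single[OF k 2(1,2)]] show ?thesis
      by simp
  qed
  then have le: "(\<Sum>i<n. b k i * (M - gain k i)) + (\<beta> k - (\<Sum>i<n. b k i)) * M \<le> 0"
    by (simp add: algebra_simps sum_subtractf sum_distrib_left)
  have term_nonneg: "0 \<le> b k i * (M - gain k i)" for i
    using row gain_le[of i] by (cases "b k i = 0") (auto simp: rows_def)
  have slack_nonneg: "0 \<le> (\<beta> k - (\<Sum>i<n. b k i)) * M"
    using row M_nonneg by (simp add: rows_def)
  have "0 \<le> (\<Sum>i<n. b k i * (M - gain k i))"
    by (intro sum_nonneg term_nonneg)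
  with le slack_nonneg have "(\<Sum>i<n. b k i * (M - gain k i)) = 0"
    and slack: "(\<beta> k - (\<Sum>i<n. b k i)) * M = 0"
    by linarith+
  then have tight: "b k i * (M - gain k i) = 0" if "i < n" for i
    using that term_nonneg by (subst (asm) sum_nonneg_eq_0_iff) auto
  have exp_gain: "r k i = exp (gain k i) * (q i / s i)" if "i < n" "0 < r k i" for i
    using that spent_pos[of i] s_pos[of i] by (simp add: gain_def exp_diff)
  show ?thesis
  proof (intro exI[of _ "exp M"] conjI allI impI)
    show "1 \<le> exp M"
      using M_nonneg by simp
  next
    fix i assume i: "i < n"
    have nonneg: "0 \<le> q i / s i"
      using spent_pos[OF i] s_pos[OF i] by simp
    show "r k i \<le> exp M * (q i / s i)"
    proof (cases "0 < r k i")
      case True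
      have "exp (gain k i) * (q i / s i) \<le> exp M * (q i / s i)"
        using gain_le[OF i True] nonneg by (intro mult_right_mono) simp_all
      with exp_gain[OF i True] show ?thesis
        by simp
    next
      case False
      have "0 \<le> exp M * (q i / s i)"
        using nonneg by (intro mult_nonneg_nonneg) auto
      with False show ?thesis by simp
    qed
  next
    fix i assume i: "i < n" and "0 < b k i"
    then have "gain k i = M" "0 < r k i"
      using tight[OF i] row by (auto simp: rows_def)
    with exp_gain[OF i] show "r k i = exp M * (q i / s i)"
      by simp
  next
    assume "(\<Sum>i<n. b k i) < \<beta> k"
    with slack show "exp M = 1" by simp
  qed
qed

end

section \<open>The market with money\<close>

lemma dot_Suc: "dot (Suc n) x y = dot n x y + x n * y n"
  by (simp add: dot_def)

lemma dot_add_right: "dot n x (\<lambda>i. y i + z i) = dot n x y + dot n x z"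
  by (simp add: dot_def sum.distrib distrib_left)

lemma dot_single: "i < n \<Longrightarrow> dot n x (\<lambda>j. if j = i then c else 0) = x i * c"
  unfolding dot_def by (subst sum.remove[of _ i]) auto

text \<open>The extra good \<open>num_goods A\<close> is money; the extra agent \<open>num_bids A\<close> sells the goods for it.\<close>

definition money_market :: "auction \<Rightarrow> market" where
  "money_market A =
     \<lparr>market_goods = Suc (num_goods A),
      market_agents = Suc (num_bids A),
      endowment = (\<lambda>k i.
        if k < num_bids A then (if i < num_goods A then 0 else budget A k)
        else (if i < num_goods A then good_supply A i else 0)),
      utility = (\<lambda>k i.
        if i < num_goods A then (if k < num_bids A then bid_value A k i else 0) else 1)\<rparr>"

text \<open>The allocation is passed on unchanged: the seller's row and the money column fall
  outside the smaller dimensions.\<close>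

definition money_normalised :: "auction \<times> outcome \<Rightarrow> outcome" where
  "money_normalised = (\<lambda>(A, e).
     \<lparr>outcome_goods = num_goods A,
      outcome_recipients = num_bids A,
      price = (\<lambda>i. price e i / price e (num_goods A)),
      alloc = alloc e\<rparr>)"

lemma money_market_simps [simp]:
  "market_goods (money_market A) = Suc (num_goods A)"
  "market_agents (money_market A) = Suc (num_bids A)"
  "k < num_bids A \<Longrightarrow> endowment (money_market A) k i = (if i < num_goods A then 0 else budget A k)"
  "endowment (money_market A) (num_bids A) i = (if i < num_goods A then good_supply A i else 0)"
  "k < num_bids A \<Longrightarrow> utility (money_market A) k i = (if i < num_goods A then bid_value A k i else 1)"
  "utility (money_market A) (num_bids A) i = (if i < num_goods A then 0 else 1)"
  by (simp_all add: money_market_def)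

lemma money_market_dots [simp]:
  "k < num_bids A \<Longrightarrow> dot (num_goods A) p (endowment (money_market A) k) = 0"
  "dot (num_goods A) p (endowment (money_market A) (num_bids A)) = dot (num_goods A) p (good_supply A)"
  "k < num_bids A \<Longrightarrow>
    dot (num_goods A) (utility (money_market A) k) x = dot (num_goods A) (bid_value A k) x"
  "dot (num_goods A) (utility (money_market A) (num_bids A)) x = 0"
  by (simp_all add: dot_def)

lemma bid_demand_iff:
  assumes "k < num_bids A"
  shows "x \<in> market_demand (money_market A) p k \<longleftrightarrow>
    is_arg_max (\<lambda>x. dot (num_goods A) (bid_value A k) x + x (num_goods A))
      (\<lambda>x. (\<forall>i\<le>num_goods A. 0 \<le> x i) \<and>
        dot (num_goods A) p x + p (num_goods A) * x (num_goods A) \<le> p (num_goods A) * budget A k) x"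
  using assms by (simp add: market_demand_def dot_Suc less_Suc_eq_le)

lemma seller_demand_iff:
  "x \<in> market_demand (money_market A) p (num_bids A) \<longleftrightarrow>
    is_arg_max (\<lambda>x. x (num_goods A))
      (\<lambda>x. (\<forall>i\<le>num_goods A. 0 \<le> x i) \<and>
        dot (num_goods A) p x + p (num_goods A) * x (num_goods A) \<le> dot (num_goods A) p (good_supply A)) x"
  by (simp add: market_demand_def dot_Suc less_Suc_eq_le)

lemma (in arctic_auction) linear_exchange_money_market: "linear_exchange_market (money_market A)"
  using s_pos \<beta>_nonneg r_nonneg
  by (auto simp: linear_exchange_market_def money_market_def less_imp_le)

section \<open>An optimal plan gives a market equilibrium\<close>

context optimal_plan
begin

definition p :: "nat \<Rightarrow> real" where
  "p i = (if i < n then q i / s i else 1)"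

lemma p_good: "i < n \<Longrightarrow> p i = q i / s i"
  and p_money [simp]: "p n = 1"
  by (simp_all add: p_def)

definition money_equilibrium :: outcome where
  "money_equilibrium =
     \<lparr>outcome_goods = Suc n,
      outcome_recipients = Suc m,
      price = p,
      alloc = (\<lambda>k i.
        if k < m then (if i < n then b k i / p i else \<beta> k - (\<Sum>i<n. b k i))
        else (if i < n then 0 else \<Sum>i<n. q i))\<rparr>"

lemma p_pos: "0 < p i"
  using spent_pos s_pos by (simp add: p_def)

text \<open>Weak duality: since \<open>r k i \<le> \<mu> * p i\<close> and
  \<open>1 \<le> \<mu>\<close>, no affordable bundle has utility above
  \<open>\<mu> * \<beta> k\<close>. Complementary slackness makes the bundle bought by the plan
  attain this bound.\<close>

lemma bid_optimal:
  assumes k: "k < m"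
  shows "alloc money_equilibrium k \<in> market_demand (money_market A) p k"
proof -
  define x where "x = alloc money_equilibrium k"
  have row: "b k \<in> rows k"
    using k by (rule b_row)
  obtain \<mu> where \<mu>: "1 \<le> \<mu>" "\<And>i. i < n \<Longrightarrow> r k i \<le> \<mu> * p i"
      "\<And>i. i < n \<Longrightarrow> 0 < b k i \<Longrightarrow> r k i = \<mu> * p i" "(\<Sum>i<n. b k i) < \<beta> k \<longrightarrow> \<mu> = 1"
    using complementary_slackness[OF k] by (auto simp: p_def)
  have x: "x i = b k i / p i" if "i < n" for i
    using k that by (simp add: x_def money_equilibrium_def)
  have money: "x n = \<beta> k - (\<Sum>i<n. b k i)"
    using k by (simp add: x_def money_equilibrium_def)
  have nonneg: "0 \<le> x i" if "i \<le> n" for i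
    using that x[of i] money row p_pos[of i] by (cases "i = n") (auto simp: rows_def less_imp_le)
  have "dot n p x = (\<Sum>i<n. b k i)"
    unfolding dot_def using p_pos by (intro sum.cong) (simp_all add: x less_imp_neq[symmetric])
  have "dot n (r k) x = (\<Sum>i<n. \<mu> * b k i)"
    unfolding dot_def
  proof (intro sum.cong refl)
    fix i assume "i \<in> {..<n}"
    then show "r k i * x i = \<mu> * b k i"
      using \<mu>(3)[of i] x[of i] p_pos[of i] plans_nonneg[OF plan, of k i]
      by (cases "b k i = 0") (auto simp: less_le)
  qed
  \<comment> \<open>Either no money is kept, so \<open>x n = 0\<close>, or the budget is slack and
    \<open>\<mu> = 1\<close>.\<close>
  moreover have "x n = \<mu> * x n"
    using \<mu>(4) row money by (cases "(\<Sum>i<n. b k i) = \<beta> k") (auto simp: rows_def)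
  ultimately have utility: "dot n (r k) x + x n = \<mu> * \<beta> k"
    by (simp add: money sum_distrib_left[symmetric] algebra_simps)
  have "dot n (r k) y + y n \<le> \<mu> * \<beta> k"
    if y: "\<forall>i\<le>n. 0 \<le> y i" "dot n p y + y n \<le> \<beta> k" for y
  proof -
    have "dot n (r k) y \<le> (\<Sum>i<n. \<mu> * (p i * y i))"
      unfolding dot_def
    proof (rule sum_mono)
      fix i assume "i \<in> {..<n}"
      then have "r k i * y i \<le> \<mu> * p i * y i"
        using y(1) \<mu>(2)[of i] by (intro mult_right_mono) auto
      then show "r k i * y i \<le> \<mu> * (p i * y i)"
        by (simp add: mult.assoc)
    qed
    also have "\<dots> = \<mu> * dot n p y"
      by (simp add: dot_def sum_distrib_left)
    finally have "dot n (r k) y + y n \<le> \<mu> * dot n p y + \<mu> * y n"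
      using \<mu>(1) y(1) mult_right_mono[of 1 \<mu> "y n"] by simp
    also have "\<dots> \<le> \<mu> * \<beta> k"
      using \<mu>(1) y(2) by (simp add: distrib_left[symmetric])
    finally show ?thesis .
  qed
  then show ?thesis
    unfolding x_def[symmetric] bid_demand_iff[OF k] is_arg_max_linorder
    using nonneg utility \<open>dot n p x = _\<close> by (auto simp: money)
qed

text \<open>At these prices the supply is worth exactly the total spending, and buying any good
  would only leave less income for money.\<close>

lemma seller_optimal:
  "alloc money_equilibrium m \<in> market_demand (money_market A) p m"
proof -
  have "dot n p s = (\<Sum>i<n. q i)"
    unfolding dot_def using s_pos by (intro sum.cong) (auto simp: p_good less_imp_neq[symmetric])
  moreover have "dot n p (alloc money_equilibrium m) = 0"
    by (simp add: dot_def money_equilibrium_def)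
  moreover have "0 \<le> dot n p y" if "\<forall>i\<le>n. 0 \<le> y i" for y
    unfolding dot_def using that p_pos by (intro sum_nonneg mult_nonneg_nonneg) (auto simp: less_imp_le)
  moreover have "0 \<le> (\<Sum>i<n. q i)"
    by (intro sum_nonneg spent_nonneg plan)
  moreover have "alloc money_equilibrium m i = (if i < n then 0 else \<Sum>i<n. q i)" for i
    by (simp add: money_equilibrium_def)
  ultimately show ?thesis
    unfolding seller_demand_iff is_arg_max_linorder by (simp; smt (verit))
qed

lemma market_equilibrium_money_market: "market_equilibrium (money_market A) money_equilibrium"
proof -
  have "alloc money_equilibrium a \<in> market_demand (money_market A) p a" if "a < Suc m" for a
    using that bid_optimal seller_optimal by (auto simp: less_Suc_eq)
  moreover have "(\<Sum>a<Suc m. alloc money_equilibrium a i) = (\<Sum>a<Suc m. endowment (money_market A) a i)"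
    if "i < Suc n" for i
  proof (cases "i = n")
    case True
    \<comment> \<open>Money clears because the seller receives, good by good, what the bids pay, bid
      by bid.\<close>
    have "(\<Sum>k<m. \<Sum>i<n. b k i) = (\<Sum>i<n. q i)"
      unfolding spent_def by (rule sum.swap)
    then show ?thesis
      by (simp add: True money_equilibrium_def sum_subtractf)
  next
    case False
    with that have i: "i < n" by simp
    have "(\<Sum>k<m. b k i / p i) = q i / p i"
      by (simp add: spent_def sum_divide_distrib)
    also have "\<dots> = s i"
      using spent_pos[OF i] by (simp add: p_good i)
    finally show ?thesis
      using i by (simp add: money_equilibrium_def)
  qed
  ultimately show ?thesis
    unfolding market_equilibrium_def
    using p_pos by (simp add: less_imp_le) (simp add: money_equilibrium_def less_imp_le)
qed

end

lemma (in arctic_auction) ex_market_equilibrium: "\<exists>e. market_equilibrium (money_market A) e"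
proof -
  obtain b where "b \<in> plans" "\<forall>b'\<in>plans. potential b' \<le> potential b"
    using ex_optimal_plan by blast
  then interpret optimal_plan A b
    by unfold_locales auto
  show ?thesis
    using market_equilibrium_money_market by blast
qed

section \<open>From any market equilibrium to an auction equilibrium\<close>

locale money_market_equilibrium = arctic_auction +
  fixes e :: outcome
  assumes equilibrium: "market_equilibrium (money_market A) e"
begin

abbreviation "P \<equiv> price e"
abbreviation "x \<equiv> alloc e"

lemma P_nonneg: "i \<le> n \<Longrightarrow> 0 \<le> P i"
  and x_demand: "a \<le> m \<Longrightarrow> x a \<in> market_demand (money_market A) P a"
  and clearing: "i \<le> n \<Longrightarrow> (\<Sum>a\<le>m. x a i) = (\<Sum>a\<le>m. endowment (money_market A) a i)"
  using equilibrium by (auto simp: market_equilibrium_def less_Suc_eq_le lessThan_Suc_atMost)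

lemma seller: "is_arg_max (\<lambda>x. x n)
    (\<lambda>x. (\<forall>i\<le>n. 0 \<le> x i) \<and> dot n P x + P n * x n \<le> dot n P s) (x m)"
  using x_demand[of m] by (simp add: seller_demand_iff)

lemma bid: "k < m \<Longrightarrow> is_arg_max (\<lambda>x. dot n (r k) x + x n)
    (\<lambda>x. (\<forall>i\<le>n. 0 \<le> x i) \<and> dot n P x + P n * x n \<le> P n * \<beta> k) (x k)"
  using x_demand[of k] by (simp add: bid_demand_iff)

lemma seller_max:
  "\<lbrakk>\<And>i. i \<le> n \<Longrightarrow> 0 \<le> y i; dot n P y + P n * y n \<le> dot n P s\<rbrakk> \<Longrightarrow> y n \<le> x m n"
  using seller by (simp add: is_arg_max_linorder)

lemma bid_max:
  "\<lbrakk>k < m; \<And>i. i \<le> n \<Longrightarrow> 0 \<le> y i; dot n P y + P n * y n \<le> P n * \<beta> k\<rbrakk> \<Longrightarrow>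
    dot n (r k) y + y n \<le> dot n (r k) (x k) + x k n"
  using bid[of k] by (simp add: is_arg_max_linorder)

lemma x_nonneg: "a \<le> m \<Longrightarrow> i \<le> n \<Longrightarrow> 0 \<le> x a i"
  using seller bid[of a] by (cases "a = m") (auto simp: is_arg_max_linorder)

lemma dot_upd: "dot n y (z(n := c)) = dot n y z"
  by (simp add: dot_def)

text \<open>If money were free, the seller could add one more unit to its bundle, contradicting
  optimality.\<close>

lemma money_price_pos: "0 < P n"
proof (rule ccontr)
  assume "\<not> 0 < P n"
  with P_nonneg[of n] have zero: "P n = 0" by simp
  let ?y = "(x m)(n := x m n + 1)"
  have "?y n \<le> x m n"
    using seller zero by (intro seller_max[where y = ?y]) (auto simp: is_arg_max_linorder dot_upd)
  then show False by simp
qed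

text \<open>The same argument with a bid that values the good; the standing assumption supplies
  one.\<close>

lemma price_pos:
  assumes i: "i < n"
  shows "0 < P i"
proof (rule ccontr)
  assume "\<not> 0 < P i"
  with P_nonneg[of i] i have zero: "P i = 0" by simp
  obtain k where k: "k < m" "0 < r k i"
    using good_wanted[OF i] by blast
  let ?y = "\<lambda>j. x k j + (if j = i then 1 else 0)"
  have "dot n (r k) ?y + ?y n \<le> dot n (r k) (x k) + x k n"
    using bid[OF k(1)] zero i
    by (intro bid_max[where y = ?y] k(1)) (auto simp: is_arg_max_linorder dot_add_right dot_single)
  with i k(2) show False
    by (simp add: dot_add_right dot_single)
qed

text \<open>The seller could turn its whole income into money, so an optimal bundle holds at least
  that much money. Nothing is left to pay for goods, all of which have positive prices.\<close>

lemma seller_keeps_nothing: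
  assumes i: "i < n"
  shows "x m i = 0"
proof -
  let ?y = "\<lambda>j. if j = n then dot n P s / P n else 0"
  have zero: "dot n P ?y = 0"
    by (simp add: dot_def)
  have "0 \<le> dot n P s"
    unfolding dot_def using price_pos s_pos by (intro sum_nonneg) (simp add: less_imp_le)
  then have "?y n \<le> x m n"
    using money_price_pos zero by (intro seller_max[where y = ?y]) simp_all
  then have "dot n P s \<le> P n * x m n"
    using money_price_pos by (simp add: divide_le_eq mult.commute)
  then have "dot n P (x m) \<le> 0"
    using seller by (auto simp: is_arg_max_linorder)
  moreover have nonneg: "0 \<le> P j * x m j" if "j < n" for j
    using price_pos[OF that] x_nonneg[of m j] that by simp
  ultimately have "(\<Sum>j<n. P j * x m j) = 0"
    unfolding dot_def by (intro order_antisym sum_nonneg) auto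
  then have "P i * x m i = 0"
    using i nonneg by (subst (asm) sum_nonneg_eq_0_iff) auto
  with price_pos[OF i] show ?thesis by simp
qed

lemma supply_sold: "i < n \<Longrightarrow> (\<Sum>k<m. x k i) = s i"
  using clearing[of i] seller_keeps_nothing[of i]
  by (simp add: lessThan_Suc_atMost[symmetric])

lemma dot_normalised: "dot n (\<lambda>i. P i / P n) y = dot n P y / P n"
  by (simp add: dot_def sum_divide_distrib)

text \<open>Completing an auction bundle by the unspent budget as money turns its surplus into
  market utility, up to the constant \<open>\<beta> k\<close>. Hence a better auction bundle would
  give a better market bundle.\<close>

lemma bid_demand_normalised:
  assumes k: "k < m"
  shows "x k \<in> auction_demand A (\<lambda>i. P i / P n) k"
proof -
  let ?p = "\<lambda>i. P i / P n"
  have surplus: "dot n (\<lambda>i. r k i - ?p i) y = dot n (r k) y - dot n ?p y" for y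
    by (simp add: dot_def left_diff_distrib sum_subtractf)
  \<comment> \<open>This bounds the money kept, so that the market utility of \<open>x k\<close> is
    at most its surplus plus \<open>\<beta> k\<close>.\<close>
  have afford: "dot n ?p (x k) + x k n \<le> \<beta> k"
    using bid[OF k] money_price_pos by (simp add: dot_normalised is_arg_max_linorder field_simps)
  moreover have "dot n (r k) y - dot n ?p y \<le> dot n (r k) (x k) - dot n ?p (x k)"
    if y: "\<forall>i<n. 0 \<le> y i" "dot n ?p y \<le> \<beta> k" for y
  proof -
    let ?z = "y(n := \<beta> k - dot n ?p y)"
    have "dot n (r k) ?z + ?z n \<le> dot n (r k) (x k) + x k n"
      using y money_price_pos
      by (intro bid_max[where y = ?z] k) (auto simp: dot_upd dot_normalised right_diff_distrib)
    with afford show ?thesis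
      by (simp add: dot_upd)
  qed
  moreover have "dot n ?p (x k) \<le> \<beta> k"
    using afford x_nonneg[of k n] k by simp
  moreover have "\<forall>i<n. 0 \<le> x k i"
    using x_nonneg[of k] k by simp
  ultimately show ?thesis
    by (simp add: auction_demand_def is_arg_max_linorder surplus)
qed

text \<open>Revenue is maximal term by term, since all prices are positive and every good is sold up
  to its supply.\<close>

lemma auction_equilibrium_normalised: "auction_equilibrium A (money_normalised (A, e))"
proof -
  let ?p = "\<lambda>i. P i / P n"
  have "dot n ?p y \<le> dot n ?p (\<lambda>i. \<Sum>k<m. x k i)" if "\<forall>i<n. 0 \<le> y i \<and> y i \<le> s i" for y
    unfolding dot_def using that money_price_pos price_pos
    by (intro sum_mono mult_left_mono) (auto simp: supply_sold less_imp_le)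
  then show ?thesis
    using money_price_pos price_pos bid_demand_normalised s_pos
    by (auto simp: auction_equilibrium_def money_normalised_def is_arg_max_linorder supply_sold
        less_imp_le)
qed

end

section \<open>Encoding lengths and program execution\<close>

definition short :: "nat \<Rightarrow> real set" where
  "short B = {w \<in> \<rat>. rat_length w \<le> B}"

lemma shortI: "w \<in> \<rat> \<Longrightarrow> rat_length w \<le> B \<Longrightarrow> w \<in> short B"
  by (simp add: short_def)

lemma short_mono: "w \<in> short B \<Longrightarrow> B \<le> B' \<Longrightarrow> w \<in> short B'"
  by (simp add: short_def)

lemma rat_length_of_rat:
  "rat_length (of_rat q) = (case quotient_of q of (a, b) \<Rightarrow> int_length a + int_length b)"
  by (simp add: rat_length_def)

lemma int_length_mono: "\<bar>a\<bar> \<le> \<bar>b\<bar> \<Longrightarrow> int_length a \<le> int_length b"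
  by (simp add: int_length_def floorlog_mono nat_mono)

lemma int_length_0 [simp]: "int_length 0 = 1"
  and int_length_1 [simp]: "int_length 1 = 2"
  by (simp_all add: int_length_def floorlog_def)

lemma rat_length_of_nat: "rat_length (real i) = int_length (int i) + 2"
  using rat_length_of_rat[of "of_nat i"] by simp

lemma floorlog_Suc_le: "floorlog 2 (Suc i) \<le> Suc (floorlog 2 i)"
proof (rule floorlog_leI)
  have "i < 2 ^ floorlog 2 i"
    by (rule floorlog_leD) auto
  then show "Suc i < 2 ^ Suc (floorlog 2 i)"
    by simp
qed auto

text \<open>The 3 is one bit for passing from \<open>j\<close> to \<open>Suc j\<close> and 2 for the
  denominator 1. The successor is allowed because the market has one good and one agent more than
  the auction has goods and bids.\<close>

lemma short_of_nat:
  assumes "i \<le> Suc j" "int_length (int j) \<le> B"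
  shows "real i \<in> short (B + 3)"
proof (rule shortI)
  have "int_length (int i) \<le> int_length (int (Suc j))"
    using assms(1) by (intro int_length_mono) simp
  also have "\<dots> \<le> Suc (int_length (int j))"
    using floorlog_Suc_le[of j] by (simp add: int_length_def del: of_nat_Suc)
  finally show "rat_length (real i) \<le> B + 3"
    using assms(2) by (simp add: rat_length_of_nat)
qed simp

lemma floorlog_mult_le: "floorlog 2 (x * y) \<le> floorlog 2 x + floorlog 2 y"
proof (rule floorlog_leI)
  have "x < 2 ^ floorlog 2 x" "y < 2 ^ floorlog 2 y"
    by (auto intro: floorlog_leD)
  then show "x * y < 2 ^ (floorlog 2 x + floorlog 2 y)"
    by (simp add: power_add mult_strict_mono)
qed auto

lemma int_length_mult_le: "int_length (a * b) \<le> int_length a + int_length b"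
  using floorlog_mult_le[of "nat \<bar>a\<bar>" "nat \<bar>b\<bar>"]
  by (simp add: int_length_def abs_mult nat_mult_distrib)

text \<open>Cancelling common factors does not lengthen numerator and denominator.\<close>

lemma rat_length_fraction:
  assumes "b \<noteq> 0"
  shows "rat_length (of_int a / of_int b) \<le> int_length a + int_length b"
proof -
  obtain c d where cd: "quotient_of (of_int a / of_int b) = (c, d)"
    by fastforce
  have "0 < d" "coprime c d"
    using cd by (auto dest: quotient_of_denom_pos quotient_of_coprime)
  moreover have "(of_int a / of_int b :: rat) = of_int c / of_int d"
    using cd by (rule quotient_of_div)
  ultimately have "(of_int (a * d) :: rat) = of_int (c * b)"
    using assms by (simp add: field_simps)
  then have eq: "a * d = c * b"
    by (simp only: of_int_eq_iff)
  have "d dvd b"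
    using eq \<open>coprime c d\<close> by (metis coprime_commute coprime_dvd_mult_right_iff dvd_triv_right)
  then obtain e where e: "b = d * e" ..
  with eq \<open>0 < d\<close> have "a = c * e"
    by simp
  with e assms have "\<bar>c\<bar> \<le> \<bar>a\<bar>" "\<bar>d\<bar> \<le> \<bar>b\<bar>"
    by (auto simp: abs_mult mult_le_cancel_left1)
  moreover have "rat_length (of_int a / of_int b) = int_length c + int_length d"
    using rat_length_of_rat[of "of_int a / of_int b"] cd by (simp add: of_rat_divide)
  ultimately show ?thesis
    by (simp add: add_mono int_length_mono)
qed

text \<open>Numerator and denominator are cross-multiplied and lengths of products add up. The 3
  covers a zero divisor: then the quotient is 0, of length 3.\<close>

lemma short_divide:
  assumes "x \<in> short B" "y \<in> short C"
  shows "x / y \<in> short (B + C + 3)"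
proof (cases "y = 0")
  case True
  then show ?thesis
    using rat_length_of_nat[of 0] by (simp add: short_def)
next
  case False
  obtain u v where uv: "x = of_rat u" "y = of_rat v"
    using assms by (auto simp: short_def elim!: Rats_cases)
  obtain a b c d where q: "quotient_of u = (a, b)" "quotient_of v = (c, d)"
    by (meson surj_pair)
  then have "0 < b" "0 < d"
    by (auto dest: quotient_of_denom_pos)
  have x: "x = of_int a / of_int b" and y: "y = of_int c / of_int d"
    using q[THEN quotient_of_div] by (simp_all add: uv of_rat_divide)
  have "x / y = of_int (a * d) / of_int (b * c)"
    by (simp add: x y)
  moreover have "b * c \<noteq> 0"
    using False y \<open>0 < b\<close> by auto
  ultimately have "rat_length (x / y) \<le> int_length (a * d) + int_length (b * c)"
    by (metis rat_length_fraction)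
  also have "\<dots> \<le> (int_length a + int_length d) + (int_length b + int_length c)"
    by (intro add_mono int_length_mult_le)
  also have "\<dots> = rat_length x + rat_length y"
    using q by (simp add: uv rat_length_of_rat)
  finally show ?thesis
    using assms by (simp add: short_def)
qed

lemma data_length_dim:
  assumes "j \<in> set (fst d)"
  shows "int_length (int j) \<le> data_length d"
proof -
  have "int_length (int j) \<le> (\<Sum>n\<leftarrow>fst d. int_length (int n))"
    using assms by (intro member_le_sum_list) auto
  then show ?thesis
    by (simp add: data_length_def)
qed

lemma data_length_entry:
  assumes "(r, c, M) \<in> set (snd d)" "i < r" "j < c"
  shows "rat_length (M i j) \<le> data_length d"
proof -
  have "rat_length (M i j) \<le> (\<Sum>j<c. rat_length (M i j))"
    using assms by (intro member_le_sum) auto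
  also have "\<dots> \<le> (\<Sum>i<r. \<Sum>j<c. rat_length (M i j))"
    using assms by (intro member_le_sum[of i _ "\<lambda>i. \<Sum>j<c. rat_length (M i j)"]) auto
  also have "\<dots> \<le> (\<Sum>(r, c, M)\<leftarrow>snd d. \<Sum>i<r. \<Sum>j<c. rat_length (M i j))"
    using assms by (intro member_le_sum_list) (force, simp)
  finally show ?thesis
    by (simp add: data_length_def)
qed

text \<open>The 3 is the length of 0, found in all cells outside the input matrices.\<close>

lemma short_load_cell:
  assumes "rational_data d"
  shows "cell (load d) a i j \<in> short (data_length d + 3)"
proof (cases "a < length (snd d) \<and> i < fst (snd d ! a) \<and> j < fst (snd (snd d ! a))")
  case True
  obtain r c M where entry: "snd d ! a = (r, c, M)"
    by (metis prod_cases3)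
  then have mem: "(r, c, M) \<in> set (snd d)"
    using True by (metis nth_mem)
  have "rat_length (M i j) \<le> data_length d"
    using True entry by (intro data_length_entry[OF mem]) auto
  moreover have "M i j \<in> \<rat>"
    using assms mem True entry by (fastforce simp: rational_data_def)
  ultimately show ?thesis
    using True entry by (simp add: load_def short_def)
next
  case False
  then have "cell (load d) a i j = 0"
    by (auto simp: load_def split: prod.splits)
  then show ?thesis
    using rat_length_of_nat[of 0] by (simp add: short_def)
qed

text \<open>A total-correctness judgement that also bounds the time by \<open>N\<close> and confines
  all written numbers to \<open>V\<close>. The rest of a program can sit in the postcondition, as in
  \<open>runs_seq\<close>, so that sequences are verified by chaining introduction rules.\<close>

definition runs ::
  "real set \<Rightarrow> nat \<Rightarrow> program \<Rightarrow> machine \<Rightarrow> (machine \<Rightarrow> bool) \<Rightarrow> bool" where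
  "runs V N P s Q \<longleftrightarrow> (\<exists>t W s'. exec P s t W s' \<and> t \<le> N \<and> W \<subseteq> V \<and> Q s')"

lemma runsI: "exec P s t W s' \<Longrightarrow> t \<le> N \<Longrightarrow> W \<subseteq> V \<Longrightarrow> Q s' \<Longrightarrow> runs V N P s Q"
  by (auto simp: runs_def)

lemma runs_weaken:
  "runs V N P s Q \<Longrightarrow> N \<le> N' \<Longrightarrow> (\<And>t. Q t \<Longrightarrow> Q' t) \<Longrightarrow> runs V N' P s Q'"
  by (force simp: runs_def)

lemma runs_idx_const: "1 \<le> N \<Longrightarrow> real n \<in> V \<Longrightarrow> Q (write_idx s u n) \<Longrightarrow> runs V N (Idx_Const u n) s Q"
  by (rule runsI[OF exec.idx_const]) auto

lemma runs_idx_copy: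
  "1 \<le> N \<Longrightarrow> real (idx s v) \<in> V \<Longrightarrow> Q (write_idx s u (idx s v)) \<Longrightarrow> runs V N (Idx_Copy u v) s Q"
  by (rule runsI[OF exec.idx_copy]) auto

lemma runs_idx_inc:
  "1 \<le> N \<Longrightarrow> real (Suc (idx s u)) \<in> V \<Longrightarrow> Q (write_idx s u (Suc (idx s u))) \<Longrightarrow> runs V N (Idx_Inc u) s Q"
  by (rule runsI[OF exec.idx_inc]) auto

lemma runs_real_const:
  "1 \<le> N \<Longrightarrow> of_int z \<in> V \<Longrightarrow> Q (write_cell s a (of_int z)) \<Longrightarrow> runs V N (Real_Const a z) s Q"
  by (rule runsI[OF exec.real_const]) auto

lemma runs_real_copy:
  "1 \<le> N \<Longrightarrow> read_cell s b \<in> V \<Longrightarrow> Q (write_cell s a (read_cell s b)) \<Longrightarrow> runs V N (Real_Copy a b) s Q"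
  by (rule runsI[OF exec.real_copy]) auto

lemma runs_real_div:
  "1 \<le> N \<Longrightarrow> read_cell s c \<noteq> 0 \<Longrightarrow> read_cell s b / read_cell s c \<in> V \<Longrightarrow>
    Q (write_cell s a (read_cell s b / read_cell s c)) \<Longrightarrow> runs V N (Real_Arith Div a b c) s Q"
  by (rule runsI[OF exec.real_arith]) auto

lemma runs_seq:
  "runs V N P s (\<lambda>t. runs V N' P' t Q) \<Longrightarrow> runs V (N + N') (Seq P P') s Q"
  unfolding runs_def by (blast intro: exec.seq add_mono)

text \<open>Both branches share one time bound, which is why the rules for single instructions
  accept any \<open>N\<close> of at least 1.\<close>

lemma runs_if:
  "(test_value b s \<Longrightarrow> runs V N P s Q) \<Longrightarrow> (\<not> test_value b s \<Longrightarrow> runs V N P' s Q) \<Longrightarrow>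
    runs V (Suc N) (If b P P') s Q"
  unfolding runs_def by (cases "test_value b s") (meson exec.if_true exec.if_false Suc_le_mono)+

section \<open>Counting loops and filling of matrices\<close>

definition for_loop :: "nat \<Rightarrow> nat \<Rightarrow> program \<Rightarrow> program" where
  "for_loop u v P = Seq (Idx_Const u 0) (While (Idx_Less u v) (Seq P (Idx_Inc u)))"

text \<open>Each round costs \<open>N\<close> plus a test and an increment; the final 2 pays for the
  initial assignment and the failing test. \<open>Inv\<close> describes the head of the loop, hence
  \<open>step\<close> asks for it in the state with the counter already incremented.\<close>

lemma runs_for_loop:
  assumes V: "\<And>j. j \<le> b \<Longrightarrow> real j \<in> V"
    and bound: "\<And>j t. Inv j t \<Longrightarrow> idx t v = b"
    and counter: "\<And>j t. Inv j t \<Longrightarrow> idx t u = j"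
    and init: "Inv 0 (write_idx s u 0)"
    and step: "\<And>j t. j < b \<Longrightarrow> Inv j t \<Longrightarrow>
      runs V N P t (\<lambda>t'. idx t' u = j \<and> Inv (Suc j) (write_idx t' u (Suc j)))"
  shows "runs V (b * (N + 2) + 2) (for_loop u v P) s (Inv b)"
proof -
  have loop: "runs V (d * (N + 2) + 1) (While (Idx_Less u v) (Seq P (Idx_Inc u))) t (Inv b)"
    if "Inv j t" "j + d = b" for d j t
    using that
  proof (induction d arbitrary: j t)
    case 0
    then have "\<not> test_value (Idx_Less u v) t"
      by (simp add: bound counter)
    with 0 show ?case
      by (intro runsI[OF exec.while_false]) auto
  next
    case (Suc d)
    then have test: "test_value (Idx_Less u v) t"
      by (simp add: bound counter)
    obtain t1 W1 s1 where 1: "exec P t t1 W1 s1" "t1 \<le> N" "W1 \<subseteq> V" "idx s1 u = j"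
        "Inv (Suc j) (write_idx s1 u (Suc j))"
      using step[of j t] Suc.prems by (auto simp: runs_def)
    from Suc.IH[OF 1(5)] Suc.prems obtain t2 W2 s2 where 2:
        "exec (While (Idx_Less u v) (Seq P (Idx_Inc u))) (write_idx s1 u (Suc j)) t2 W2 s2"
        "t2 \<le> d * (N + 2) + 1" "W2 \<subseteq> V" "Inv b s2"
      by (auto simp: runs_def)
    have 3: "exec (Seq P (Idx_Inc u)) t (t1 + 1) (W1 \<union> {real (Suc j)}) (write_idx s1 u (Suc j))"
      using exec.seq[OF 1(1) exec.idx_inc[of u s1]] 1(4) by simp
    show ?case
      by (rule runsI[OF exec.while_true[OF test 3 2(1)]])
        (use 1 2 V[of "Suc j"] Suc.prems in auto)
  qed
  have "runs V (1 + (b * (N + 2) + 1)) (for_loop u v P) s (Inv b)"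
    unfolding for_loop_def
    by (intro runs_seq runs_idx_const loop[OF init]) (use V[of 0] in auto)
  then show ?thesis
    by simp
qed

text \<open>Index registers 4 and 5 are the row and column counters.\<close>

definition fill :: "nat \<Rightarrow> nat \<Rightarrow> program \<Rightarrow> program" where
  "fill u v P = for_loop 4 u (for_loop 5 v P)"

definition same_idx :: "machine \<Rightarrow> machine \<Rightarrow> bool" where
  "same_idx s t \<longleftrightarrow> (\<forall>w. w \<noteq> 4 \<and> w \<noteq> 5 \<longrightarrow> idx t w = idx s w)"

lemma write_idx_simps [simp]:
  "idx (write_idx s u k) w = (if w = u then k else idx s w)"
  "cell (write_idx s u k) = cell s"
  by (simp_all add: write_idx_def)

lemma write_cell_simps [simp]:
  "idx (write_cell s (a, u, v) x) = idx s"
  "cell (write_cell s (a, u, v) x) a' i j =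
    (if a' = a \<and> i = idx s u \<and> j = idx s v then x else cell s a' i j)"
  by simp_all

declare write_cell.simps [simp del]

text \<open>The body may rely on every array except the target \<open>a\<close>, because only
  \<open>a\<close> changes during the fill. A row costs 4 beyond its entries: 2 inside the inner
  loop and 2 in the outer one.\<close>

lemma runs_fill:
  assumes uv: "u \<noteq> 4" "u \<noteq> 5" "v \<noteq> 4" "v \<noteq> 5"
    and V: "\<And>i. i \<le> idx s u \<or> i \<le> idx s v \<Longrightarrow> real i \<in> V"
    and body: "\<And>t. same_idx s t \<Longrightarrow> (\<And>a' i j. a' \<noteq> a \<Longrightarrow> cell t a' i j = cell s a' i j) \<Longrightarrow>
      idx t 4 < idx s u \<Longrightarrow> idx t 5 < idx s v \<Longrightarrow>
      runs V N P t (\<lambda>t'. t' = write_cell t (a, 4, 5) (F (idx t 4) (idx t 5)))"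
  shows "runs V (idx s u * (idx s v * (N + 2) + 4) + 2) (fill u v P) s
    (\<lambda>t. same_idx s t \<and> (\<forall>a' i j. cell t a' i j =
      (if a' = a \<and> i < idx s u \<and> j < idx s v then F i j else cell s a' i j)))"
proof -
  define filled where "filled S t \<longleftrightarrow> same_idx s t \<and> (\<forall>a' i j. cell t a' i j =
      (if a' = a \<and> (i, j) \<in> S then F i j else cell s a' i j))" for S t
  define done_rows where "done_rows i = {..<i} \<times> {..<idx s v}" for i :: nat
  \<comment> \<open>The entries finished when the counters stand at \<open>(i, j)\<close>.\<close>
  define cells where "cells i j = done_rows i \<union> {i} \<times> {..<j}" for i j
  have cells_Suc: "cells i (Suc j) = insert (i, j) (cells i j)" for i j
    by (auto simp: cells_def)
  have row: "runs V (idx s v * (N + 2) + 2) (for_loop 5 v P) t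
      (\<lambda>t'. filled (cells i (idx s v)) t' \<and> idx t' 4 = i \<and> idx t' 5 = idx s v)"
    if i: "i < idx s u" and t: "filled (done_rows i) t" "idx t 4 = i" for i t
  proof (rule runs_for_loop[where Inv = "\<lambda>j t'. filled (cells i j) t' \<and> idx t' 4 = i \<and> idx t' 5 = j"])
    show "filled (cells i 0) (write_idx t 5 0) \<and> idx (write_idx t 5 0) 4 = i \<and>
        idx (write_idx t 5 0) 5 = 0"
      using t by (simp add: filled_def cells_def same_idx_def)
  next
    fix j t'
    assume j: "j < idx s v" and t': "filled (cells i j) t' \<and> idx t' 4 = i \<and> idx t' 5 = j"
    then have "runs V N P t' (\<lambda>t''. t'' = write_cell t' (a, 4, 5) (F i j))"
      using body[of t'] i by (auto simp: filled_def)
    then show "runs V N P t' (\<lambda>t''. idx t'' 5 = j \<and> filled (cells i (Suc j)) (write_idx t'' 5 (Suc j))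
        \<and> idx (write_idx t'' 5 (Suc j)) 4 = i \<and> idx (write_idx t'' 5 (Suc j)) 5 = Suc j)"
      by (rule runs_weaken) (use t' in \<open>auto simp: filled_def cells_Suc same_idx_def\<close>)
  qed (use uv V in \<open>auto simp: filled_def same_idx_def\<close>)
  have "runs V (idx s u * ((idx s v * (N + 2) + 2) + 2) + 2) (fill u v P) s
      (\<lambda>t. filled (done_rows (idx s u)) t \<and> idx t 4 = idx s u)"
    unfolding fill_def
  proof (rule runs_for_loop[where Inv = "\<lambda>i t. filled (done_rows i) t \<and> idx t 4 = i"])
    fix i t
    assume i: "i < idx s u" and t: "filled (done_rows i) t \<and> idx t 4 = i"
    have "cells i (idx s v) = done_rows (Suc i)"
      by (auto simp: cells_def done_rows_def less_Suc_eq)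
    then show "runs V (idx s v * (N + 2) + 2) (for_loop 5 v P) t
        (\<lambda>t'. idx t' 4 = i \<and> filled (done_rows (Suc i)) (write_idx t' 4 (Suc i)) \<and>
          idx (write_idx t' 4 (Suc i)) 4 = Suc i)"
      using t by (intro runs_weaken[OF row[OF i]]) (auto simp: filled_def same_idx_def)
  qed (use uv V in \<open>auto simp: filled_def done_rows_def same_idx_def\<close>)
  then show ?thesis
    by (rule runs_weaken) (auto simp: filled_def done_rows_def algebra_simps)
qed

definition filled ::
  "nat \<Rightarrow> nat \<Rightarrow> nat \<Rightarrow> (nat \<Rightarrow> nat \<Rightarrow> real) \<Rightarrow>
    (nat \<Rightarrow> nat \<Rightarrow> nat \<Rightarrow> real) \<Rightarrow> nat \<Rightarrow> nat \<Rightarrow> nat \<Rightarrow> real" where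
  "filled a R C F c = (\<lambda>a' i j. if a' = a \<and> i < R \<and> j < C then F i j else c a' i j)"

text \<open>The form used for chaining: registers are compared with one fixed state
  \<open>s0\<close>, the memory is carried along as an explicit function, and the arbitrary
  \<open>Q\<close> leaves room for the remaining program.\<close>

lemma runs_fill_from:
  assumes s: "same_idx s0 s" "cell s = c"
    and dims: "idx s0 u = R" "idx s0 v = C"
    and uv: "u \<noteq> 4" "u \<noteq> 5" "v \<noteq> 4" "v \<noteq> 5"
    and V: "\<And>i. i \<le> R \<or> i \<le> C \<Longrightarrow> real i \<in> V"
    and body: "\<And>t. same_idx s0 t \<Longrightarrow> (\<And>a' i j. a' \<noteq> a \<Longrightarrow> cell t a' i j = c a' i j) \<Longrightarrow>
      idx t 4 < R \<Longrightarrow> idx t 5 < C \<Longrightarrow>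
      runs V N P t (\<lambda>t'. t' = write_cell t (a, 4, 5) (F (idx t 4) (idx t 5)))"
    and Q: "\<And>t. same_idx s0 t \<Longrightarrow> cell t = filled a R C F c \<Longrightarrow> Q t"
  shows "runs V (R * (C * (N + 2) + 4) + 2) (fill u v P) s Q"
proof -
  have idx: "idx s u = R" "idx s v = C"
    using s(1) dims uv by (simp_all add: same_idx_def)
  have same: "same_idx s0 t" if "same_idx s t" for t
    using that s(1) by (simp add: same_idx_def)
  have "runs V (idx s u * (idx s v * (N + 2) + 4) + 2) (fill u v P) s
    (\<lambda>t. same_idx s t \<and> (\<forall>a' i j. cell t a' i j =
      (if a' = a \<and> i < idx s u \<and> j < idx s v then F i j else cell s a' i j)))"
    by (rule runs_fill[OF uv]) (use V body same s(2) in \<open>auto simp: idx\<close>)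
  then show ?thesis
    unfolding idx
    by (rule runs_weaken) (use Q same s(2) in \<open>auto simp: filled_def fun_eq_iff\<close>)
qed

section \<open>The two maps\<close>

text \<open>
  Register 6 is never written and supplies the index 0. The seller's zero entries are partly read
  from the zero padding of the loaded matrices.
\<close>

definition forward_program :: program where
  "forward_program =
     Seq (Idx_Copy 2 0) (Seq (Idx_Inc 2) (Seq (Idx_Copy 3 1) (Seq (Idx_Inc 3)
     (Seq (fill 3 2
        (If (Idx_Less 4 1)
          (If (Idx_Less 5 0) (Real_Const (3, 4, 5) 0) (Real_Copy (3, 4, 5) (1, 6, 4)))
          (Real_Copy (3, 4, 5) (0, 6, 5))))
     (Seq (fill 3 2
        (If (Idx_Less 5 0) (Real_Copy (1, 4, 5) (2, 4, 5)) (Real_Const (1, 4, 5) 1)))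
     (Seq (fill 3 2 (Real_Copy (0, 4, 5) (3, 4, 5)))
     (Seq (Idx_Copy 0 2) (Idx_Copy 1 3))))))))"

lemma load_auction:
  "idx (load (auction_data A)) 0 = num_goods A"
  "idx (load (auction_data A)) (Suc 0) = num_bids A"
  "u \<ge> 2 \<Longrightarrow> idx (load (auction_data A)) u = 0"
  "cell (load (auction_data A)) 0 0 i = (if i < num_goods A then good_supply A i else 0)"
  "cell (load (auction_data A)) (Suc 0) 0 k = (if k < num_bids A then budget A k else 0)"
  "cell (load (auction_data A)) 2 k i =
    (if k < num_bids A \<and> i < num_goods A then bid_value A k i else 0)"
  by (auto simp: load_def auction_data_def)

lemma stores_market_data:
  "stores t (market_data E) \<longleftrightarrow> idx t 0 = market_goods E \<and> idx t (Suc 0) = market_agents E \<and>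
    (\<forall>k<market_agents E. \<forall>i<market_goods E.
      cell t 0 k i = endowment E k i \<and> cell t (Suc 0) k i = utility E k i)"
  by (auto simp: stores_def market_data_def All_less_Suc2 numeral_2_eq_2)

lemma stores_outcome_data:
  "stores t (outcome_data e) \<longleftrightarrow>
    idx t 0 = outcome_goods e \<and> idx t (Suc 0) = outcome_recipients e \<and>
    (\<forall>i<outcome_goods e. cell t 0 0 i = price e i) \<and>
    (\<forall>k<outcome_recipients e. \<forall>i<outcome_goods e. cell t (Suc 0) k i = alloc e k i)"
  by (auto simp: stores_def outcome_data_def All_less_Suc2 numeral_2_eq_2)

lemma runs_forward_program:
  assumes "rational_data (auction_data A)"
  defines "n \<equiv> num_goods A" and "m \<equiv> num_bids A"
  shows "runs (short (data_length (auction_data A) + 3))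
    (12 + 3 * (Suc m * (5 * Suc n + 4))) forward_program (load (auction_data A))
    (\<lambda>t. stores t (market_data (money_market A)))"
proof -
  define V where "V = short (data_length (auction_data A) + 3)"
  define s where "s = load (auction_data A)"
  define s1 where "s1 = write_idx (write_idx s 2 (Suc n)) 3 (Suc m)"
  define E where "E = endowment (money_market A)"
  define U where "U = utility (money_market A)"
  \<comment> \<open>The endowments are assembled in the scratch array 3, because they are read from
    arrays 0 and 1, which still hold supplies and budgets. Only then are arrays 1 and 0
    overwritten.\<close>
  define c where "c = filled 3 (Suc m) (Suc n) E (cell s)"
  define c' where "c' = filled 1 (Suc m) (Suc n) U c"
  have dims: "int_length (int n) \<le> data_length (auction_data A)"
      "int_length (int m) \<le> data_length (auction_data A)"
    by (auto intro!: data_length_dim simp: auction_data_def n_def m_def)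
  have V_idx: "real i \<in> V" if "i \<le> Suc n \<or> i \<le> Suc m" for i
    using that dims short_of_nat unfolding V_def by blast
  have V_0: "0 \<in> V" and V_1: "1 \<in> V"
    using V_idx[of 0] V_idx[of 1] by simp_all
  have V_cell: "cell s a i j \<in> V" for a i j
    unfolding V_def s_def using assms(1) by (rule short_load_cell)
  have s: "idx s 0 = n" "idx s (Suc 0) = m" "idx s 6 = 0"
    by (simp_all add: s_def load_auction n_def m_def)
  have s1: "idx s1 0 = n" "idx s1 (Suc 0) = m" "idx s1 2 = Suc n" "idx s1 3 = Suc m" "idx s1 6 = 0"
      "cell s1 = cell s"
    by (simp_all add: s1_def s)
  have E: "E i j = (if i < m then if j < n then 0 else cell s (Suc 0) 0 i else cell s 0 0 j)"
    if "i < Suc m" "j < Suc n" for i j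
    using that by (auto simp: E_def s_def load_auction n_def m_def less_Suc_eq)
  have U: "U i j = (if j < n then cell s 2 i j else 1)" if "i < Suc m" for i j
    using that by (auto simp: U_def s_def load_auction n_def m_def less_Suc_eq)
  have V_E: "E i j \<in> V" if "i < Suc m" "j < Suc n" for i j
    by (simp add: E[OF that] V_0 V_cell)
  have final: "runs V (1 + 1) (Seq (Idx_Copy 0 2) (Idx_Copy 1 3)) t
      (\<lambda>t. stores t (market_data (money_market A)))"
    if "same_idx s1 t" "cell t = filled 0 (Suc m) (Suc n) E c'" for t
  proof -
    have "idx t 2 = Suc n" "idx t 3 = Suc m"
      using that(1) by (simp_all add: same_idx_def s1)
    then show ?thesis
      by (intro runs_seq runs_idx_copy)
        (simp_all add: V_idx stores_market_data that(2) filled_def c'_def n_def m_def E_def U_def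
          del: of_nat_Suc)
  qed
  have copy_E: "runs V (Suc m * (Suc n * (1 + 2) + 4) + 2)
      (fill 3 2 (Real_Copy (0, 4, 5) (3, 4, 5))) t Q"
    if t: "same_idx s1 t" "cell t = c'"
      and Q: "\<And>t. same_idx s1 t \<Longrightarrow> cell t = filled 0 (Suc m) (Suc n) E c' \<Longrightarrow> Q t"
    for t Q
    using t
  proof (rule runs_fill_from)
    fix t' :: machine
    assume t': "\<And>a i j. a \<noteq> 0 \<Longrightarrow> cell t' a i j = c' a i j"
      and lt: "idx t' 4 < Suc m" "idx t' 5 < Suc n"
    have "cell t' 3 (idx t' 4) (idx t' 5) = E (idx t' 4) (idx t' 5)"
      using t' lt by (simp add: c'_def c_def filled_def)
    then show "runs V 1 (Real_Copy (0, 4, 5) (3, 4, 5)) t'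
        (\<lambda>t''. t'' = write_cell t' (0, 4, 5) (E (idx t' 4) (idx t' 5)))"
      by (intro runs_real_copy) (simp_all add: V_E[OF lt])
  qed (auto simp: s1 V_idx Q)
  have fill_U: "runs V (Suc m * (Suc n * (Suc 1 + 2) + 4) + 2) (fill 3 2
        (If (Idx_Less 5 0) (Real_Copy (1, 4, 5) (2, 4, 5)) (Real_Const (1, 4, 5) 1))) t Q"
    if t: "same_idx s1 t" "cell t = c"
      and Q: "\<And>t. same_idx s1 t \<Longrightarrow> cell t = c' \<Longrightarrow> Q t" for t Q
    using t
  proof (rule runs_fill_from)
    fix t' :: machine
    assume t': "same_idx s1 t'" "\<And>a i j. a \<noteq> 1 \<Longrightarrow> cell t' a i j = c a i j"
      and lt: "idx t' 4 < Suc m" "idx t' 5 < Suc n"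
    have "idx t' 0 = n"
      using t'(1) by (simp add: same_idx_def s1)
    moreover have "cell t' 2 i j = cell s 2 i j" for i j
      using t'(2) by (simp add: c_def filled_def)
    ultimately show "runs V (Suc 1)
        (If (Idx_Less 5 0) (Real_Copy (1, 4, 5) (2, 4, 5)) (Real_Const (1, 4, 5) 1)) t'
        (\<lambda>t''. t'' = write_cell t' (1, 4, 5) (U (idx t' 4) (idx t' 5)))"
      by (intro runs_if runs_real_const runs_real_copy) (simp_all add: U[OF lt(1)] V_cell V_1)
  qed (auto simp: s1 V_idx Q c'_def)
  have fill_E: "runs V (Suc m * (Suc n * (Suc (Suc 1) + 2) + 4) + 2) (fill 3 2
        (If (Idx_Less 4 1)
          (If (Idx_Less 5 0) (Real_Const (3, 4, 5) 0) (Real_Copy (3, 4, 5) (1, 6, 4)))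
          (Real_Copy (3, 4, 5) (0, 6, 5)))) t Q"
    if t: "same_idx s1 t" "cell t = cell s"
      and Q: "\<And>t. same_idx s1 t \<Longrightarrow> cell t = c \<Longrightarrow> Q t" for t Q
    using t
  proof (rule runs_fill_from)
    fix t' :: machine
    assume t': "same_idx s1 t'" "\<And>a i j. a \<noteq> 3 \<Longrightarrow> cell t' a i j = cell s a i j"
      and lt: "idx t' 4 < Suc m" "idx t' 5 < Suc n"
    have "idx t' 0 = n" "idx t' (Suc 0) = m" "idx t' 6 = 0"
      using t'(1) by (simp_all add: same_idx_def s1)
    then show "runs V (Suc (Suc 1)) (If (Idx_Less 4 1)
          (If (Idx_Less 5 0) (Real_Const (3, 4, 5) 0) (Real_Copy (3, 4, 5) (1, 6, 4)))
          (Real_Copy (3, 4, 5) (0, 6, 5))) t'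
        (\<lambda>t''. t'' = write_cell t' (3, 4, 5) (E (idx t' 4) (idx t' 5)))"
      by (intro runs_if runs_real_const runs_real_copy)
        (simp_all add: t'(2) E[OF lt] V_cell V_0)
  qed (auto simp: s1 V_idx Q c_def)
  have s1_eq: "write_idx (write_idx (write_idx (write_idx s 2 n) 2 (Suc n)) 3 m) 3 (Suc m) = s1"
    by (simp add: s1_def write_idx_def fun_eq_iff)
  have "runs V (1 + (1 + (1 + (1 + (Suc m * (Suc n * (Suc (Suc 1) + 2) + 4) + 2 +
      (Suc m * (Suc n * (Suc 1 + 2) + 4) + 2 + (Suc m * (Suc n * (1 + 2) + 4) + 2 + (1 + 1))))))))
      forward_program s (\<lambda>t. stores t (market_data (money_market A)))"
    unfolding forward_program_def
    by (intro final runs_seq runs_idx_copy runs_idx_inc fill_E fill_U copy_E)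
      (simp_all add: s V_idx s1_eq same_idx_def s1 del: of_nat_Suc)
  \<comment> \<open>An entry costs at most 5: two tests and one write, plus 2 for the loop. The 12
    consists of six register instructions and 2 for each of the three fills.\<close>
  then have "runs V (12 + 3 * (Suc m * (5 * Suc n + 4))) forward_program s
      (\<lambda>t. stores t (market_data (money_market A)))"
    by (rule runs_weaken) (simp_all add: algebra_simps)
  then show ?thesis
    by (simp only: V_def s_def)
qed

lemma strongly_polynomial_mapI:
  fixes T L :: "nat poly"
  assumes "\<And>a. a \<in> D \<Longrightarrow> runs (short (poly L (data_length (enc_in a)))) (poly T (dims a)) P
      (load (enc_in a)) (\<lambda>t. stores t (enc_out (f a)))"
  shows "strongly_polynomial_map dims enc_in enc_out D f"
  unfolding strongly_polynomial_map_def
proof (rule exI[of _ P], rule exI[of _ T], rule exI[of _ L], rule ballI)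
  fix a assume "a \<in> D"
  then show "\<exists>t W s. exec P (load (enc_in a)) t W s \<and> stores s (enc_out (f a)) \<and>
      t \<le> poly T (dims a) \<and>
      (rational_data (enc_in a) \<longrightarrow>
        (\<forall>w\<in>W. w \<in> \<rat> \<and> rat_length w \<le> poly L (data_length (enc_in a))))"
    using assms[of a] unfolding runs_def short_def by blast
qed

lemma strongly_polynomial_money_market:
  "strongly_polynomial_map auction_size auction_data market_data rational_auctions money_market"
proof (rule strongly_polynomial_mapI)
  fix A assume "A \<in> rational_auctions"
  then have "rational_data (auction_data A)"
    by (simp add: rational_auctions_def)
  note runs_forward_program[OF this]
  moreover have "12 + 3 * (Suc (num_bids A) * (5 * Suc (num_goods A) + 4))
      \<le> 12 + 3 * (Suc (auction_size A) * (5 * Suc (auction_size A) + 4))"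
    by (intro add_mono mult_mono) (simp_all add: auction_size_def)
  ultimately have "runs (short (data_length (auction_data A) + 3))
      (12 + 3 * (Suc (auction_size A) * (5 * Suc (auction_size A) + 4))) forward_program
      (load (auction_data A)) (\<lambda>t. stores t (market_data (money_market A)))"
    by (rule runs_weaken)
  \<comment> \<open>In terms of the size \<open>x\<close>, the factors are \<open>x + 1\<close> and
    \<open>5 * (x + 1) + 4 = 5 * x + 9\<close>.\<close>
  moreover have "12 + 3 * (Suc (auction_size A) * (5 * Suc (auction_size A) + 4))
      = poly ([:12:] + [:3:] * [:1, 1:] * [:9, 5:]) (auction_size A)"
    by (simp add: algebra_simps)
  ultimately show "runs (short (poly [:3, 1:] (data_length (auction_data A))))
      (poly ([:12:] + [:3:] * [:1, 1:] * [:9, 5:]) (auction_size A)) forward_program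
      (load (auction_data A)) (\<lambda>t. stores t (market_data (money_market A)))"
    by (simp add: add.commute)
qed

text \<open>In the joined input, arrays 3 and 4 hold the prices and the allocation. Register 0
  contains the number of goods, which is both the column bound of the fills and, in the address
  \<open>(3, 6, 0)\<close>, the column of the price of money. Registers 0 and 1 already contain the
  output dimensions.\<close>

definition reverse_program :: program where
  "reverse_program =
     Seq (Idx_Const 7 1)
     (Seq (fill 7 0 (Real_Arith Div (0, 4, 5) (3, 4, 5) (3, 6, 0)))
       (fill 1 0 (Real_Copy (1, 4, 5) (4, 4, 5))))"

lemma load_auction_outcome:
  fixes A e
  defines "t \<equiv> load (join_data (auction_data A) (outcome_data e))"
  shows "idx t 0 = num_goods A" "idx t (Suc 0) = num_bids A" "u \<ge> 4 \<Longrightarrow> idx t u = 0"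
    "i < outcome_goods e \<Longrightarrow> cell t 3 0 i = price e i"
    "k < outcome_recipients e \<Longrightarrow> i < outcome_goods e \<Longrightarrow> cell t 4 k i = alloc e k i"
  by (auto simp: t_def load_def join_data_def auction_data_def outcome_data_def)

lemma runs_reverse_program:
  assumes rat: "rational_data (join_data (auction_data A) (outcome_data e))"
    and e: "outcome_goods e = Suc (num_goods A)" "outcome_recipients e = Suc (num_bids A)"
    and pos: "price e (num_goods A) \<noteq> 0"
  defines "n \<equiv> num_goods A" and "m \<equiv> num_bids A"
    and "B \<equiv> data_length (join_data (auction_data A) (outcome_data e))"
  shows "runs (short (2 * B + 9)) (5 + Suc m * (3 * n + 4)) reverse_program
    (load (join_data (auction_data A) (outcome_data e)))
    (\<lambda>t. stores t (outcome_data (money_normalised (A, e))))"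
proof -
  define V where "V = short (2 * B + 9)"
  define s where "s = load (join_data (auction_data A) (outcome_data e))"
  define s1 where "s1 = write_idx s 7 1"
  define p where "p i = price e i / price e n" for i
  define c where "c = filled 0 1 n (\<lambda>_. p) (cell s)"
  have dims: "int_length (int n) \<le> B" "int_length (int m) \<le> B"
    by (auto intro!: data_length_dim simp: B_def join_data_def auction_data_def n_def m_def)
  have V_idx: "real i \<in> V" if "i \<le> Suc n \<or> i \<le> Suc m" for i
  proof -
    have "real i \<in> short (B + 3)"
      using that dims short_of_nat by blast
    then show ?thesis
      unfolding V_def by (rule short_mono) simp
  qed
  have cell: "cell s a i j \<in> short (B + 3)" for a i j
    unfolding B_def s_def using rat by (rule short_load_cell)
  then have V_cell: "cell s a i j \<in> V" for a i j
    unfolding V_def by (rule short_mono) simp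
  \<comment> \<open>Two cells of length at most \<open>B + 3\<close> have a quotient of length at
    most \<open>2 * (B + 3) + 3\<close>, the origin of \<open>2 * B + 9\<close>.\<close>
  have V_div: "cell s a i j / cell s a' i' j' \<in> V" for a i j a' i' j'
    unfolding V_def using short_divide[OF cell cell] by (rule short_mono) simp
  have s: "idx s 0 = n" "idx s (Suc 0) = m" "idx s 6 = 0"
    by (simp_all add: s_def load_auction_outcome n_def m_def)
  have s1: "idx s1 0 = n" "idx s1 (Suc 0) = m" "idx s1 6 = 0" "idx s1 7 = 1" "cell s1 = cell s"
    by (simp_all add: s1_def s)
  have price: "cell s 3 0 i = price e i" if "i \<le> n" for i
    using that e by (simp add: s_def load_auction_outcome n_def)
  have alloc: "cell s 4 k i = alloc e k i" if "k < m" "i < n" for k i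
    using that e by (simp add: s_def load_auction_outcome n_def m_def)
  have fill_price: "runs V (1 * (n * (1 + 2) + 4) + 2)
      (fill 7 0 (Real_Arith Div (0, 4, 5) (3, 4, 5) (3, 6, 0))) t Q"
    if t: "same_idx s1 t" "cell t = cell s"
      and Q: "\<And>t. same_idx s1 t \<Longrightarrow> cell t = c \<Longrightarrow> Q t" for t Q
    using t
  proof (rule runs_fill_from)
    fix t' :: machine
    assume t': "same_idx s1 t'" "\<And>a i j. a \<noteq> 0 \<Longrightarrow> cell t' a i j = cell s a i j"
      and lt: "idx t' 4 < 1" "idx t' 5 < n"
    have "idx t' 0 = n" "idx t' 6 = 0"
      using t'(1) by (simp_all add: same_idx_def s1)
    then have read: "read_cell t' (3, 4, 5) = cell s 3 0 (idx t' 5)"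
        "read_cell t' (3, 6, 0) = cell s 3 0 n"
      using t'(2) lt by simp_all
    show "runs V 1 (Real_Arith Div (0, 4, 5) (3, 4, 5) (3, 6, 0)) t'
        (\<lambda>t''. t'' = write_cell t' (0, 4, 5) (p (idx t' 5)))"
      by (rule runs_real_div, simp_all only: read)
        (use lt pos V_div[of 3 0 "idx t' 5" 3 0 n] in \<open>simp_all add: price p_def n_def\<close>)
  qed (auto simp: s1 V_idx Q c_def)
  have fill_alloc: "runs V (m * (n * (1 + 2) + 4) + 2)
      (fill 1 0 (Real_Copy (1, 4, 5) (4, 4, 5))) t
      (\<lambda>t. stores t (outcome_data (money_normalised (A, e))))"
    if t: "same_idx s1 t" "cell t = c" for t
    using t
  proof (rule runs_fill_from)
    fix t' :: machine
    assume t': "\<And>a i j. a \<noteq> 1 \<Longrightarrow> cell t' a i j = c a i j"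
      and lt: "idx t' 4 < m" "idx t' 5 < n"
    have read: "cell t' 4 (idx t' 4) (idx t' 5) = cell s 4 (idx t' 4) (idx t' 5)"
      using t' by (simp add: c_def filled_def)
    show "runs V 1 (Real_Copy (1, 4, 5) (4, 4, 5)) t'
        (\<lambda>t''. t'' = write_cell t' (1, 4, 5) (alloc e (idx t' 4) (idx t' 5)))"
      using alloc[OF lt] V_cell[of 4 "idx t' 4" "idx t' 5"]
      by (intro runs_real_copy) (simp_all add: read)
  next
    fix t' :: machine
    assume t': "same_idx s1 t'" "cell t' = filled 1 m n (alloc e) c"
    have "idx t' 0 = n" "idx t' (Suc 0) = m"
      using t'(1) by (simp_all add: same_idx_def s1)
    then show "stores t' (outcome_data (money_normalised (A, e)))"
      by (simp add: stores_outcome_data money_normalised_def t'(2) filled_def c_def p_def n_def m_def)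
  qed (auto simp: s1 V_idx)
  have "runs V (1 + (1 * (n * (1 + 2) + 4) + 2 + (m * (n * (1 + 2) + 4) + 2))) reverse_program s
      (\<lambda>t. stores t (outcome_data (money_normalised (A, e))))"
    unfolding reverse_program_def
    by (intro runs_seq runs_idx_const fill_price fill_alloc)
      (use V_idx[of 1] in \<open>simp_all add: same_idx_def s1_def\<close>)
  \<comment> \<open>One row of prices and \<open>m\<close> rows of the allocation cost
    \<open>3 * n + 4\<close> each; the 5 is one register instruction and 2 per fill.\<close>
  then have "runs V (5 + Suc m * (3 * n + 4)) reverse_program s
      (\<lambda>t. stores t (outcome_data (money_normalised (A, e))))"
    by (rule runs_weaken) (simp_all add: algebra_simps)
  then show ?thesis
    by (simp only: V_def s_def)
qed

lemma strongly_polynomial_money_normalised: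
  "strongly_polynomial_map (\<lambda>(A, e). auction_size A)
    (\<lambda>(A, e). join_data (auction_data A) (outcome_data e)) outcome_data
    (SIGMA A:rational_auctions. rational_equilibria (money_market A)) money_normalised"
proof (rule strongly_polynomial_mapI)
  fix a assume "a \<in> (SIGMA A:rational_auctions. rational_equilibria (money_market A))"
  then obtain A e where a: "a = (A, e)" and "A \<in> rational_auctions"
      and "e \<in> rational_equilibria (money_market A)"
    by auto
  then have A: "costless_arctic_auction A" and e: "market_equilibrium (money_market A) e"
      and rat: "rational_data (join_data (auction_data A) (outcome_data e))"
    by (auto simp: rational_auctions_def rational_equilibria_def rational_data_def join_data_def)
  from A e interpret money_market_equilibrium A e
    by unfold_locales
  have "outcome_goods e = Suc n" "outcome_recipients e = Suc m"
    using e by (simp_all add: market_equilibrium_def)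
  \<comment> \<open>A positive price of money is what makes the divisions executable at all.\<close>
  from runs_reverse_program[OF rat this] money_price_pos
  have "runs (short (2 * data_length (join_data (auction_data A) (outcome_data e)) + 9))
      (5 + Suc m * (3 * n + 4)) reverse_program
      (load (join_data (auction_data A) (outcome_data e)))
      (\<lambda>t. stores t (outcome_data (money_normalised (A, e))))"
    by simp
  moreover have "5 + Suc m * (3 * n + 4) \<le> 5 + Suc (auction_size A) * (3 * auction_size A + 4)"
    by (intro add_mono mult_mono) (simp_all add: auction_size_def)
  ultimately have "runs (short (2 * data_length (join_data (auction_data A) (outcome_data e)) + 9))
      (5 + Suc (auction_size A) * (3 * auction_size A + 4)) reverse_program
      (load (join_data (auction_data A) (outcome_data e)))
      (\<lambda>t. stores t (outcome_data (money_normalised (A, e))))"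
    by (rule runs_weaken)
  moreover have "5 + Suc (auction_size A) * (3 * auction_size A + 4)
      = poly ([:5:] + [:1, 1:] * [:4, 3:]) (auction_size A)"
    by (simp add: algebra_simps)
  ultimately show "runs
      (short (poly [:9, 2:]
        (data_length (case a of (A, e) \<Rightarrow> join_data (auction_data A) (outcome_data e)))))
      (poly ([:5:] + [:1, 1:] * [:4, 3:]) (case a of (A, e) \<Rightarrow> auction_size A)) reverse_program
      (load (case a of (A, e) \<Rightarrow> join_data (auction_data A) (outcome_data e)))
      (\<lambda>t. stores t (outcome_data (money_normalised a)))"
    by (simp add: a add.commute mult.commute)
qed

theorem theorem2:
  shows "\<exists>(forward :: auction \<Rightarrow> market) (reverse :: auction \<times> outcome \<Rightarrow> outcome).
    strongly_polynomial_map auction_size auction_data market_data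
      rational_auctions forward \<and>
    (\<forall>A\<in>rational_auctions.
       linear_exchange_market (forward A) \<and> (\<exists>e. market_equilibrium (forward A) e)) \<and>
    strongly_polynomial_map
      (\<lambda>(A, e). auction_size A) (\<lambda>(A, e). join_data (auction_data A) (outcome_data e)) outcome_data
      (SIGMA A:rational_auctions. rational_equilibria (forward A)) reverse \<and>
    (\<forall>A\<in>rational_auctions. \<forall>e\<in>rational_equilibria (forward A).
       auction_equilibrium A (reverse (A, e)))"
proof (rule exI[of _ money_market], rule exI[of _ money_normalised], intro conjI ballI)
  show "strongly_polynomial_map auction_size auction_data market_data rational_auctions money_market"
    by (rule strongly_polynomial_money_market)
  show "strongly_polynomial_map
      (\<lambda>(A, e). auction_size A) (\<lambda>(A, e). join_data (auction_data A) (outcome_data e)) outcome_data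
      (SIGMA A:rational_auctions. rational_equilibria (money_market A)) money_normalised"
    by (rule strongly_polynomial_money_normalised)
next
  fix A assume "A \<in> rational_auctions"
  then interpret arctic_auction A
    by unfold_locales (simp add: rational_auctions_def)
  show "linear_exchange_market (money_market A)"
    by (rule linear_exchange_money_market)
  show "\<exists>e. market_equilibrium (money_market A) e"
    by (rule ex_market_equilibrium)
  fix e assume "e \<in> rational_equilibria (money_market A)"
  then interpret money_market_equilibrium A e
    by unfold_locales (simp add: rational_equilibria_def)
  show "auction_equilibrium A (money_normalised (A, e))"
    by (rule auction_equilibrium_normalised)
qed

end
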